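(* Let $L$ be a number field and let $p$ be a rational prime. Then: (a) The prime $p$ does not ramify in $L$ if and only if $\beta_p^L = 1$. (b) The prime $p$ is totally split in $L$ if and only if $\alpha_p^L = 1$. (c) The prime $p$ is wildly ramified in $L$ if and only if $\alpha_p^L \equiv 0 \pmod p$.
   Context: A rational prime is an element of $\{2,3,5,7,\dots\}\cup\{-1\}$, where $-1$ denotes the prime at infinity. Let $n=[L:\mathbb{Q}]$. Let $g=g_p^L$ be the number of primes of $L$ lying over $p$, with ramification degrees $e_1,\dots,e_g$ and residue degrees $f_1,\dots,f_g$. Put $e_p^L=\sum_{i=1}^{g} e_i$ and $f_p^L=\sum_{i=1}^{g} f_i$. For $p=-1$ the primes over $p$ are the archimedean places: a real place has $e=f=1$, a complex place has $e=2$, $f=1$. The prime $p$ does not ramify in $L$ if all $e_i=1$; it is totally split if all $e_i=f_i=1$; a prime number $p$ is wildly ramified in $L$ if $p$ divides some $e_i$, and the prime $p=-1$ is regarded as not wildly ramified. Define $u_{-1}=-1$, $u_2=5$, and for an odd prime number $p$ let $u_p$ be the least integer $u$ with $0<u<p$ and Legendre symbol $\left(\frac{u}{p}\right)=-1$. The first and second ramification invariants are the integers $$\alpha_p^L=\left(\prod_{i=1}^{g} e_i^{f_i}\right)u_p^{\,f_p^L-g},$$ $$\beta_p^L=(-1)^{\sum_{i=1}^{g}\lfloor (e_i-1)/2\rfloor f_i}\left(\prod_{i=1}^{g} e_i^{f_i(e_i-1)}\right)u_p^{\,n-f_p^L-e_p^L+g}.$$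
   Formalization: In (c) the congruence is required only together with p ≠ -1: every integer is congruent to 0 modulo -1, while -1 is by convention not wildly ramified, so (c) read literally fails at p = -1 (for example L = Q). *)

theory Defs
  imports
    "HOL-Number_Theory.Number_Theory"
    "HOL-Algebra.Algebra"
    "HOL-Analysis.Analysis"
begin

section \<open>Number fields\<close>

definition rat_scale :: "rat \<Rightarrow> 'a::field_char_0 \<Rightarrow> 'a" where
  "rat_scale q x = of_rat q * x"

interpretation rat_scale: vector_space "rat_scale :: rat \<Rightarrow> 'a \<Rightarrow> 'a::field_char_0"
  by unfold_locales (simp_all add: rat_scale_def algebra_simps of_rat_add of_rat_mult)

definition number_field :: "'a::field_char_0 itself \<Rightarrow> bool" where
  "number_field _ \<longleftrightarrow> (\<exists>B :: 'a set. finite B \<and> rat_scale.span B = UNIV)"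

definition field_degree :: "'a::field_char_0 itself \<Rightarrow> nat" where
  "field_degree _ = rat_scale.dim (UNIV :: 'a set)"

definition ring_of_integers :: "'a::field_char_0 ring" where
  "ring_of_integers =
     \<lparr>carrier = {x. algebraic_int x}, mult = (*), one = 1, ring.zero = 0, add = (+)\<rparr>"


section \<open>Primes of a number field lying over a rational prime\<close>

text \<open>The integer \<open>-1\<close> stands for the rational prime at infinity.\<close>

definition rational_prime :: "int \<Rightarrow> bool" where
  "rational_prime p \<longleftrightarrow> p = -1 \<or> Factorial_Ring.prime p"

definition embeddings :: "('a::field_char_0 \<Rightarrow> complex) set" where
  "embeddings = {\<sigma>. \<sigma> 1 = 1 \<and> (\<forall>x y. \<sigma> (x + y) = \<sigma> x + \<sigma> y) \<and> (\<forall>x y. \<sigma> (x * y) = \<sigma> x * \<sigma> y)}"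

text \<open>
  A finite prime is a prime ideal of the ring of integers.  An archimedean place is a complex
  conjugacy class of embeddings into the complex numbers: a single embedding with real values,
  or a pair of conjugate non-real embeddings.
\<close>

datatype 'a place = Finite_Place "'a set" | Infinite_Place "('a \<Rightarrow> complex) set"

definition primes_over :: "int \<Rightarrow> 'a::field_char_0 place set" where
  "primes_over p =
     (if p = -1 then {Infinite_Place {\<sigma>, cnj \<circ> \<sigma>} | \<sigma>. \<sigma> \<in> embeddings}
      else {Finite_Place P | P. primeideal P ring_of_integers \<and> {k :: int. of_int k \<in> P} = {k. p dvd k}})"

text \<open>
  At a finite prime \<open>P\<close> over \<open>p\<close> the ramification degree is the exponent of \<open>P\<close> in the
  factorization of the ideal generated by \<open>p\<close>, taken in the monoid of ideals.  The residue
  degree is the dimension of the residue field over the image of the integers, which is the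
  field with \<open>p\<close> elements.
\<close>

fun ramification_degree :: "int \<Rightarrow> 'a::field_char_0 place \<Rightarrow> nat" where
  "ramification_degree p (Finite_Place P) =
     (GREATEST k :: nat.
        (P [^]\<^bsub>ideals_set ring_of_integers\<^esub> k) divides\<^bsub>ideals_set ring_of_integers\<^esub>
        (PIdl\<^bsub>ring_of_integers\<^esub> (of_int p)))"
| "ramification_degree p (Infinite_Place v) = (if \<forall>\<sigma>\<in>v. range \<sigma> \<subseteq> \<real> then 1 else 2)"

fun residue_degree :: "'a::field_char_0 place \<Rightarrow> nat" where
  "residue_degree (Finite_Place P) =
     ring.dim (ring_of_integers Quot P)
       (range (\<lambda>k :: int. P +>\<^bsub>ring_of_integers\<^esub> of_int k))
       (carrier (ring_of_integers Quot P))"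
| "residue_degree (Infinite_Place v) = 1"

definition not_ramified :: "'a::field_char_0 itself \<Rightarrow> int \<Rightarrow> bool" where
  "not_ramified _ p \<longleftrightarrow> (\<forall>v \<in> (primes_over p :: 'a place set). ramification_degree p v = 1)"

definition totally_split :: "'a::field_char_0 itself \<Rightarrow> int \<Rightarrow> bool" where
  "totally_split _ p \<longleftrightarrow>
     (\<forall>v \<in> (primes_over p :: 'a place set). ramification_degree p v = 1 \<and> residue_degree v = 1)"

text \<open>
  The prime at infinity is by convention not wildly ramified.  Note that every integer is
  congruent to 0 modulo the integer \<open>-1\<close>, so a criterion for wild ramification by a congruence
  modulo \<open>p\<close> has to exclude \<open>p = -1\<close> explicitly.
\<close>

definition wildly_ramified :: "'a::field_char_0 itself \<Rightarrow> int \<Rightarrow> bool" where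
  "wildly_ramified _ p \<longleftrightarrow>
     p \<noteq> -1 \<and> (\<exists>v \<in> (primes_over p :: 'a place set). p dvd int (ramification_degree p v))"


section \<open>The ramification invariants\<close>

definition num_primes :: "'a::field_char_0 itself \<Rightarrow> int \<Rightarrow> nat" where
  "num_primes _ p = card (primes_over p :: 'a place set)"

definition e_total :: "'a::field_char_0 itself \<Rightarrow> int \<Rightarrow> nat" where
  "e_total _ p = (\<Sum>v \<in> (primes_over p :: 'a place set). ramification_degree p v)"

definition f_total :: "'a::field_char_0 itself \<Rightarrow> int \<Rightarrow> nat" where
  "f_total _ p = (\<Sum>v \<in> (primes_over p :: 'a place set). residue_degree v)"

definition u_inv :: "int \<Rightarrow> int" where
  "u_inv p = (if p = -1 then -1 else if p = 2 then 5
          else int (LEAST k :: nat. 0 < k \<and> int k < p \<and> Legendre (int k) p = -1))"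

text \<open>
  The subtractions of natural numbers in the exponents below do not truncate: all \<open>e\<close> and \<open>f\<close>
  are at least 1, and since the degree is the sum of the products \<open>e * f\<close>, the exponent of
  \<open>u_inv p\<close> in the second invariant is the sum of the products \<open>(e - 1) * (f - 1)\<close>.
\<close>

definition ram_alpha :: "'a::field_char_0 itself \<Rightarrow> int \<Rightarrow> int" where
  "ram_alpha L p =
     (\<Prod>v \<in> (primes_over p :: 'a place set). int (ramification_degree p v) ^ residue_degree v)
     * u_inv p ^ (f_total L p - num_primes L p)"

definition ram_beta :: "'a::field_char_0 itself \<Rightarrow> int \<Rightarrow> int" where
  "ram_beta L p =
     (-1) ^ (\<Sum>v \<in> (primes_over p :: 'a place set).
               ((ramification_degree p v - 1) div 2) * residue_degree v)
     * (\<Prod>v \<in> (primes_over p :: 'a place set).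
          int (ramification_degree p v) ^ (residue_degree v * (ramification_degree p v - 1)))
     * u_inv p ^ (field_degree L + num_primes L p - (f_total L p + e_total L p))"

end

theory Submission
  imports
    Defs
    "Jordan_Normal_Form.Char_Poly"
    "HOL-Library.Function_Algebras"
    "HOL-Computational_Algebra.Field_as_Ring"
begin

text \<open>
  The three equivalences are arithmetic once four facts about the places over \<open>p\<close> are known: there are
  finitely many, the ramification degrees \<open>e\<close> are positive, the residue degrees \<open>f\<close> are positive,
  and if all \<open>e\<close> are \<open>1\<close> then the degree \<open>n\<close> of the field is at most the sum of the \<open>f\<close>.
  Indeed, each \<open>e\<close> divides the first invariant, and it divides the second one if it is not \<open>1\<close>.  So if
  an invariant is \<open>1\<close>, then all \<open>e\<close> are \<open>1\<close>.  As \<open>u_inv p\<close> is not a unit for a prime number \<open>p\<close>, the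
  first invariant can only be \<open>1\<close> if the exponent of \<open>u_inv p\<close> is zero, that is, if all \<open>f\<close> are \<open>1\<close>.
  Conversely, if all \<open>e\<close> are \<open>1\<close>, the inequality makes the exponent of \<open>u_inv p\<close> in the second invariant
  vanish.  Finally, a prime number \<open>p\<close> does not divide \<open>u_inv p\<close>, so it divides the first invariant only
  if it divides some \<open>e\<close>.

  Both versions of the inequality come from \<open>alg_functional_sum_of_embeddings\<close>: every rational linear
  functional on the field is a combination of complex embeddings with algebraic coefficients.  It is
  proved by splitting a functional into simultaneous eigenvectors for the action of the field, and such
  eigenvectors are multiples of embeddings.  Counting dimensions gives at least \<open>n\<close> embeddings, which
  settles the infinite prime (\<open>archimedean_degree_le\<close>).  Since the coefficients have a common
  denominator, a rational functional has bounded denominators on the algebraic integers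
  (\<open>rational_functional_denominator\<close>).  Hence the ring of integers is finite modulo \<open>p\<close>, and any set
  generating it modulo \<open>p\<close> spans the field (\<open>spans_mod_p_imp_spans\<close>).

  For the prime ideals over \<open>p\<close>, finiteness modulo \<open>p\<close> replaces the usual Noetherian arguments.  A prime
  \<open>P\<close> over \<open>p\<close> annihilates a nonzero element modulo \<open>p\<close>, which yields a non-integral \<open>\<gamma>\<close> with \<open>\<gamma> P\<close>
  integral such that \<open>1\<close> and \<open>\<gamma>\<close> generate the inverse of \<open>P\<close> (\<open>prime_over_inverse\<close>).  Then \<open>P ^ n\<close> divides
  \<open>p\<close> exactly when \<open>p * \<gamma> ^ i\<close> is integral for all \<open>i\<close> up to \<open>n\<close> (\<open>ideal_divides_p_iff\<close>), so \<open>e\<close> is at least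
  \<open>1\<close>.  If all \<open>e\<close> are \<open>1\<close>, the intersection of the primes over \<open>p\<close> consists of the multiples of \<open>p\<close>
  (\<open>unramified_intersection\<close>), and counting residue classes in the product of the residue fields gives
  the inequality (\<open>unramified_degree_le\<close>).
\<close>

section \<open>Sums and products of algebraic integers\<close>

interpretation int_span: Modules.module "\<lambda>(k::int) (x::'a::field_char_0). of_int k * x"
  by unfold_locales (simp_all add: algebra_simps)

text \<open>
  The determinant trick: multiplication by \<open>z\<close> on the generators \<open>S\<close> is described by an integer
  matrix, the vector of generators is an eigenvector of it for \<open>z\<close>, and so \<open>z\<close> is a root of the
  characteristic polynomial, which is monic with integer coefficients.
\<close>

lemma algebraic_int_if_stable_span:
  fixes z :: "'a::field_char_0"
  assumes fin: "finite S" and nz: "s0 \<in> S" "s0 \<noteq> 0"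
    and stable: "\<And>s. s \<in> S \<Longrightarrow> z * s \<in> int_span.span S"
  shows "algebraic_int z"
proof -
  obtain g :: "nat \<Rightarrow> 'a" and n where g: "bij_betw g {..<n} S"
    using ex_bij_betw_nat_finite[OF fin] by (auto simp: atLeast0LessThan)
  have "\<exists>a :: nat \<Rightarrow> int. z * g i = (\<Sum>j<n. of_int (a j) * g j)" if "i < n" for i
  proof -
    from g that have "g i \<in> S" by (auto simp: bij_betw_def)
    from stable[OF this] obtain u :: "'a \<Rightarrow> int" where "z * g i = (\<Sum>v\<in>S. of_int (u v) * v)"
      unfolding int_span.span_finite[OF fin] by auto
    also have "\<dots> = (\<Sum>j<n. of_int (u (g j)) * g j)"
      by (rule sum.reindex_bij_betw[OF g, symmetric])
    finally show ?thesis by (intro exI[of _ "\<lambda>j. u (g j)"])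
  qed
  then obtain a :: "nat \<Rightarrow> nat \<Rightarrow> int"
    where a: "\<And>i. i < n \<Longrightarrow> z * g i = (\<Sum>j<n. of_int (a i j) * g j)"
    by metis
  define A where "A = mat n n (\<lambda>(i,j). a i j)"
  define v where "v = Matrix.vec n g"
  have A: "A \<in> carrier_mat n n" by (simp add: A_def)
  have "v \<noteq> 0\<^sub>v n"
  proof
    assume v0: "v = 0\<^sub>v n"
    from nz(1) g obtain i where i: "i < n" "s0 = g i" by (auto simp: bij_betw_def)
    from i(1) have "vec_index v i = g i" by (simp add: v_def)
    with v0 i nz show False by simp
  qed
  moreover have "map_mat of_int A *\<^sub>v v = z \<cdot>\<^sub>v v"
  proof (rule eq_vecI)
    fix i assume "i < dim_vec (z \<cdot>\<^sub>v v)"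
    then have i: "i < n" by (simp add: v_def)
    then show "vec_index (map_mat of_int A *\<^sub>v v) i = vec_index (z \<cdot>\<^sub>v v) i"
      using a[OF i] by (simp add: A_def v_def scalar_prod_def atLeast0LessThan)
  qed (simp add: A_def v_def)
  ultimately have "eigenvalue (map_mat of_int A :: 'a mat) z"
    unfolding eigenvalue_def eigenvector_def
    by (intro exI[of _ v]) (simp add: A_def v_def)
  then have "poly (char_poly (map_mat of_int A :: 'a mat)) z = 0"
    using eigenvalue_root_char_poly[of "map_mat of_int A :: 'a mat" n z] A by simp
  then have "poly (map_poly of_int (char_poly A)) z = 0"
    by (simp add: of_int_hom.char_poly_hom[OF A])
  moreover have "lead_coeff (char_poly A) = 1"
    using degree_monic_char_poly[OF A] by simp
  ultimately show ?thesis
    unfolding algebraic_int_altdef_ipoly by blast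
qed

lemma algebraic_int_power_relation:
  fixes x :: "'a::field_char_0"
  assumes "algebraic_int x"
  obtains d and c :: "nat \<Rightarrow> int" where "d > 0" "x ^ d = (\<Sum>k<d. of_int (c k) * x ^ k)"
proof -
  from assms obtain p where p: "poly (map_poly of_int p) x = 0" "lead_coeff p = 1"
    unfolding algebraic_int_altdef_ipoly by blast
  define d where "d = degree p"
  have "d > 0"
  proof (rule ccontr)
    assume "\<not> d > 0"
    then obtain a where "p = [:a:]" unfolding d_def by (auto elim: degree_eq_zeroE)
    with p show False by simp
  qed
  moreover have "0 = (\<Sum>k\<le>d. of_int (coeff p k) * x ^ k)"
    using p(1) by (simp add: poly_altdef d_def coeff_map_poly)
  then have "(\<Sum>k<d. of_int (coeff p k) * x ^ k) + x ^ d = 0"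
    using p(2) by (simp add: d_def flip: lessThan_Suc_atMost)
  then have "x ^ d = (\<Sum>k<d. of_int (- coeff p k) * x ^ k)"
    by (simp add: sum_negf eq_neg_iff_add_eq_0 add.commute)
  ultimately show ?thesis by (rule that)
qed

text \<open>
  The products of small powers of \<open>x\<close> and \<open>y\<close> generate a \<open>\<int>\<close>-module that is stable under both, hence
  under \<open>x + y\<close> and \<open>x * y\<close>, to which the determinant trick applies.
\<close>

lemma algebraic_int_common_span:
  fixes x y :: "'a::field_char_0"
  assumes "algebraic_int x" "algebraic_int y"
  obtains S where "finite S" "1 \<in> S"
    "\<And>s. s \<in> int_span.span S \<Longrightarrow> x * s \<in> int_span.span S"
    "\<And>s. s \<in> int_span.span S \<Longrightarrow> y * s \<in> int_span.span S"
proof -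
  obtain d c where d: "d > 0" "x ^ d = (\<Sum>k<d. of_int (c k) * x ^ k)"
    using algebraic_int_power_relation[OF assms(1)] by blast
  obtain e b where e: "e > 0" "y ^ e = (\<Sum>k<e. of_int (b k) * y ^ k)"
    using algebraic_int_power_relation[OF assms(2)] by blast
  define S where "S = (\<lambda>(i,j). x ^ i * y ^ j) ` ({..<d} \<times> {..<e})"
  have S: "x ^ i * y ^ j \<in> int_span.span S" if "i < d" "j < e" for i j
    using that by (intro int_span.span_base) (auto simp: S_def)
  have ext: "t * s \<in> int_span.span S"
    if s: "s \<in> int_span.span S" and t: "\<And>i j. i < d \<Longrightarrow> j < e \<Longrightarrow> t * (x ^ i * y ^ j) \<in> int_span.span S"
    for t s
    using s
  proof (induction rule: int_span.span_induct_alt)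
    case base
    then show ?case by (simp add: int_span.span_zero)
  next
    case (step k u v)
    from step(1) t have "t * u \<in> int_span.span S" by (auto simp: S_def)
    then have "of_int k * (t * u) + t * v \<in> int_span.span S"
      by (intro int_span.span_add int_span.span_scale step)
    then show ?case by (simp add: algebra_simps)
  qed
  have x: "x * s \<in> int_span.span S" if "s \<in> int_span.span S" for s
  proof (rule ext[OF that])
    fix i j assume ij: "i < d" "j < e"
    show "x * (x ^ i * y ^ j) \<in> int_span.span S"
    proof (cases "Suc i < d")
      case True
      with S[of "Suc i" j] ij show ?thesis by (simp add: algebra_simps)
    next
      case False
      with ij have "x * (x ^ i * y ^ j) = x ^ d * y ^ j"
        by (metis (no_types) Suc_lessI mult.assoc power_Suc)
      also have "\<dots> = (\<Sum>k<d. of_int (c k) * (x ^ k * y ^ j))"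
        by (simp add: d(2) sum_distrib_right mult.assoc)
      also have "\<dots> \<in> int_span.span S"
        using ij by (intro int_span.span_sum int_span.span_scale S) auto
      finally show ?thesis .
    qed
  qed
  have y: "y * s \<in> int_span.span S" if "s \<in> int_span.span S" for s
  proof (rule ext[OF that])
    fix i j assume ij: "i < d" "j < e"
    show "y * (x ^ i * y ^ j) \<in> int_span.span S"
    proof (cases "Suc j < e")
      case True
      with S[of i "Suc j"] ij show ?thesis by (simp add: algebra_simps)
    next
      case False
      with ij have "e = Suc j" by simp
      then have "y * (x ^ i * y ^ j) = x ^ i * y ^ e"
        by simp
      also have "\<dots> = (\<Sum>k<e. of_int (b k) * (x ^ i * y ^ k))"
        by (simp add: e(2) sum_distrib_left algebra_simps)
      also have "\<dots> \<in> int_span.span S"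
        using ij by (intro int_span.span_sum int_span.span_scale S) auto
      finally show ?thesis .
    qed
  qed
  have "1 \<in> S"
    using d(1) e(1) by (force simp: S_def)
  moreover have "finite S" by (simp add: S_def)
  ultimately show ?thesis using that x y by blast
qed

lemma algebraic_int_add:
  fixes x y :: "'a::field_char_0"
  assumes "algebraic_int x" "algebraic_int y"
  shows "algebraic_int (x + y)"
proof -
  obtain S where S: "finite S" "1 \<in> S"
    "\<And>s. s \<in> int_span.span S \<Longrightarrow> x * s \<in> int_span.span S"
    "\<And>s. s \<in> int_span.span S \<Longrightarrow> y * s \<in> int_span.span S"
    using algebraic_int_common_span[OF assms] by blast
  show ?thesis
  proof (rule algebraic_int_if_stable_span[OF S(1,2)])
    fix s assume "s \<in> S"
    then have "x * s + y * s \<in> int_span.span S"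
      by (intro int_span.span_add S int_span.span_base)
    then show "(x + y) * s \<in> int_span.span S" by (simp add: distrib_right)
  qed simp
qed

lemma algebraic_int_mult:
  fixes x y :: "'a::field_char_0"
  assumes "algebraic_int x" "algebraic_int y"
  shows "algebraic_int (x * y)"
proof -
  obtain S where S: "finite S" "1 \<in> S"
    "\<And>s. s \<in> int_span.span S \<Longrightarrow> x * s \<in> int_span.span S"
    "\<And>s. s \<in> int_span.span S \<Longrightarrow> y * s \<in> int_span.span S"
    using algebraic_int_common_span[OF assms] by blast
  show ?thesis
  proof (rule algebraic_int_if_stable_span[OF S(1,2)])
    fix s assume "s \<in> S"
    then have "x * (y * s) \<in> int_span.span S"
      by (intro S int_span.span_base)
    then show "x * y * s \<in> int_span.span S" by (simp add: mult.assoc)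
  qed simp
qed

lemma algebraic_int_diff:
  fixes x y :: "'a::field_char_0"
  assumes "algebraic_int x" "algebraic_int y"
  shows "algebraic_int (x - y)"
  using algebraic_int_add[OF assms(1), of "- y"] assms(2) by simp

lemma algebraic_int_power:
  fixes x :: "'a::field_char_0"
  assumes "algebraic_int x"
  shows "algebraic_int (x ^ k)"
  by (induction k) (auto intro: algebraic_int_mult assms)

lemma algebraic_int_sum:
  fixes f :: "'b \<Rightarrow> 'a::field_char_0"
  assumes "\<And>i. i \<in> I \<Longrightarrow> algebraic_int (f i)"
  shows "algebraic_int (\<Sum>i\<in>I. f i)"
  using assms by (induction I rule: infinite_finite_induct) (auto intro: algebraic_int_add)

text \<open>
  If \<open>c\<close> is the leading coefficient and \<open>d\<close> the degree of an integer polynomial with root \<open>x\<close>,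
  then \<open>c ^ (d - 1)\<close> times the polynomial is monic in \<open>c * x\<close>.  Replacing \<open>c\<close> by its absolute value
  makes the multiplier a positive natural number.
\<close>

lemma algebraic_imp_multiple_int:
  fixes x :: "'a::field_char_0"
  assumes "algebraic x"
  obtains m :: nat where "m > 0" "algebraic_int (of_nat m * x)"
proof -
  obtain p where p: "p \<noteq> 0" "poly (map_poly of_int p) x = 0"
    using algebraicE'[OF assms] by blast
  define d where "d = degree p"
  define c where "c = lead_coeff p"
  have c: "c \<noteq> 0" using p by (simp add: c_def)
  have rel: "(\<Sum>k\<le>d. of_int (coeff p k) * x ^ k) = 0"
    using p(2) by (simp add: poly_altdef d_def coeff_map_poly)
  have "d > 0"
  proof (rule ccontr)
    assume "\<not> d > 0"
    then obtain a where "p = [:a:]" unfolding d_def by (auto elim: degree_eq_zeroE)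
    with p show False by simp
  qed
  let ?S = "(\<lambda>k. (of_int c * x) ^ k) ` {..<d}"
  have "algebraic_int (of_int c * x)"
  proof (rule algebraic_int_if_stable_span)
    show "1 \<in> ?S" using \<open>d > 0\<close> by force
    fix s assume "s \<in> ?S"
    then obtain k where k: "k < d" "s = (of_int c * x) ^ k" by auto
    show "of_int c * x * s \<in> int_span.span ?S"
    proof (cases "Suc k < d")
      case True
      then show ?thesis using k by (intro int_span.span_base) (auto intro!: image_eqI[of _ _ "Suc k"])
    next
      case False
      with k have "d = Suc k" by simp
      then have "of_int c * x * s = of_int c ^ (d - 1) * (of_int c * x ^ d)"
        using k by (simp add: power_mult_distrib)
      also have "of_int c * x ^ d = - (\<Sum>k<d. of_int (coeff p k) * x ^ k)"
      proof -
        have "(\<Sum>k<d. of_int (coeff p k) * x ^ k) + of_int c * x ^ d = 0"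
          using rel by (simp add: c_def d_def flip: lessThan_Suc_atMost)
        then show ?thesis by (simp add: eq_neg_iff_add_eq_0 add.commute)
      qed
      also have "of_int c ^ (d - 1) * \<dots> = (\<Sum>k<d. of_int (- coeff p k * c ^ (d - 1 - k)) * (of_int c * x) ^ k)"
        unfolding mult_minus_right sum_distrib_left sum_negf[symmetric]
      proof (rule sum.cong[OF refl])
        fix k assume "k \<in> {..<d}"
        then have "of_int c ^ (d - 1) = (of_int c ^ (d - 1 - k) * of_int c ^ k :: 'a)"
          by (simp flip: power_add)
        then show "- (of_int c ^ (d - 1) * (of_int (coeff p k) * x ^ k)) =
            of_int (- coeff p k * c ^ (d - 1 - k)) * (of_int c * x) ^ k"
          by (simp add: power_mult_distrib)
      qed
      also have "\<dots> \<in> int_span.span ?S"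
        by (intro int_span.span_sum int_span.span_scale int_span.span_base) auto
      finally show ?thesis .
    qed
  qed auto
  then have "algebraic_int (of_int (sgn c) * (of_int c * x))"
    by (rule algebraic_int_mult[OF algebraic_int_of_int])
  also have "of_int (sgn c) * (of_int c * x) = of_nat (nat \<bar>c\<bar>) * x"
    by (metis abs_sgn mult.assoc mult.commute nat_0_le abs_ge_zero of_int_mult of_int_of_nat_eq)
  finally show ?thesis
    by (rule that[rotated]) (simp add: c)
qed

lemma algebraic_if_multiple_int:
  fixes x :: "'a::field_char_0"
  assumes "m > 0" "algebraic_int (of_nat m * x)"
  shows "algebraic x"
proof -
  obtain p where p: "p \<noteq> 0" "poly (map_poly of_int p) (of_nat m * x) = 0"
    using algebraicE'[OF algebraic_int_imp_algebraic[OF assms(2)]] by blast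
  show ?thesis
  proof (rule algebraicI)
    \<comment> \<open>Substituting \<open>m\<close> times the variable.\<close>
    let ?q = "pcompose (map_poly of_int p) [:0, of_nat m :: 'a:]"
    show "coeff ?q i \<in> \<int>" for i
      by (rule coeff_pcompose_semiring_closed) (auto simp: coeff_map_poly coeff_pCons split: nat.splits)
    show "poly ?q x = 0"
      using p(2) by (simp add: poly_pcompose mult.commute)
    show "?q \<noteq> 0"
      using p(1) assms(1) by (simp add: pcompose_eq_0_iff)
  qed
qed

lemma algebraic_add:
  fixes x y :: "'a::field_char_0"
  assumes "algebraic x" "algebraic y"
  shows "algebraic (x + y)"
proof -
  obtain m k where m: "m > 0" "algebraic_int (of_nat m * x)" and k: "k > 0" "algebraic_int (of_nat k * y)"
    using assms by (meson algebraic_imp_multiple_int)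
  have "algebraic_int (of_nat k * (of_nat m * x) + of_nat m * (of_nat k * y))"
    by (intro algebraic_int_add algebraic_int_mult m k) auto
  then have "algebraic_int (of_nat (m * k) * (x + y))"
    by (simp add: algebra_simps)
  then show ?thesis using m k by (intro algebraic_if_multiple_int[of "m * k"]) auto
qed

lemma algebraic_mult:
  fixes x y :: "'a::field_char_0"
  assumes "algebraic x" "algebraic y"
  shows "algebraic (x * y)"
proof -
  obtain m k where m: "m > 0" "algebraic_int (of_nat m * x)" and k: "k > 0" "algebraic_int (of_nat k * y)"
    using assms by (meson algebraic_imp_multiple_int)
  have "algebraic_int ((of_nat m * x) * (of_nat k * y))"
    by (intro algebraic_int_mult m k)
  then have "algebraic_int (of_nat (m * k) * (x * y))"
    by (simp add: algebra_simps)
  then show ?thesis using m k by (intro algebraic_if_multiple_int[of "m * k"]) auto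
qed

section \<open>Rational functionals and complex embeddings\<close>

lemma number_field_basis:
  assumes "number_field TYPE('a::field_char_0)"
  obtains B :: "'a::field_char_0 set" where "finite B" "rat_scale.independent B" "rat_scale.span B = UNIV"
    "card B = field_degree TYPE('a)"
proof -
  obtain B0 :: "'a set" where B0: "finite B0" "rat_scale.span B0 = UNIV"
    using assms by (auto simp: number_field_def)
  obtain B :: "'a set" where B: "rat_scale.independent B" "UNIV \<subseteq> rat_scale.span B"
    "card B = rat_scale.dim (UNIV :: 'a set)"
    by (rule rat_scale.basis_exists[of "UNIV :: 'a set"]) auto
  have "finite B"
    using rat_scale.independent_span_bound[OF B0(1) B(1)] B0(2) by simp
  with B show ?thesis
    by (intro that) (auto simp: field_degree_def)
qed

definition rat_linear :: "('a::field_char_0 \<Rightarrow> 'b::field_char_0) \<Rightarrow> bool" where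
  "rat_linear \<phi> \<longleftrightarrow> (\<forall>x y. \<phi> (x + y) = \<phi> x + \<phi> y) \<and> (\<forall>q x. \<phi> (of_rat q * x) = of_rat q * \<phi> x)"

lemma rat_linear_add: "rat_linear \<phi> \<Longrightarrow> \<phi> (x + y) = \<phi> x + \<phi> y"
  and rat_linear_scale: "rat_linear \<phi> \<Longrightarrow> \<phi> (of_rat q * x) = of_rat q * \<phi> x"
  by (simp_all add: rat_linear_def)

lemma rat_linear_zero: "rat_linear \<phi> \<Longrightarrow> \<phi> 0 = 0"
  using rat_linear_scale[of \<phi> 0 0] by simp

lemma rat_linear_sum: "rat_linear \<phi> \<Longrightarrow> \<phi> (\<Sum>i\<in>I. f i) = (\<Sum>i\<in>I. \<phi> (f i))"
  by (induction I rule: infinite_finite_induct) (auto simp: rat_linear_zero rat_linear_add)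

lemma rat_linear_of_int: "rat_linear \<phi> \<Longrightarrow> \<phi> (of_int k * x) = of_int k * \<phi> x"
  using rat_linear_scale[of \<phi> "of_int k" x] by simp

lemma rat_linear_of_nat: "rat_linear \<phi> \<Longrightarrow> \<phi> (of_nat k * x) = of_nat k * \<phi> x"
  using rat_linear_scale[of \<phi> "of_nat k" x] by simp

lemma rat_linear_representation:
  assumes "rat_scale.independent B" "rat_scale.span B = UNIV"
  shows "rat_linear (\<lambda>x. rat_scale.representation B x b :: rat)"
proof -
  have "rat_scale.representation B (of_rat q * x) b = q * rat_scale.representation B x b" for q x
    using rat_scale.representation_scale[OF assms(1), of x q] assms(2) by (simp add: rat_scale_def)
  moreover have "rat_scale.representation B (x + y) b =
      rat_scale.representation B x b + rat_scale.representation B y b" for x y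
    using rat_scale.representation_add[OF assms(1), of y x] assms(2) by (simp add: add.commute)
  ultimately show ?thesis by (simp add: rat_linear_def)
qed

lemma sum_representation:
  assumes "rat_scale.independent B" "rat_scale.span B = UNIV" "finite B"
  shows "(\<Sum>b\<in>B. of_rat (rat_scale.representation B x b) * b) = x"
  using rat_scale.sum_representation_eq[OF assms(1), of x B] assms by (simp add: rat_scale_def)

lemma embedding_rat_linear:
  fixes \<sigma> :: "'a::field_char_0 \<Rightarrow> complex"
  assumes "\<sigma> \<in> embeddings"
  shows "rat_linear \<sigma>"
proof -
  have one: "\<sigma> 1 = 1" and add: "\<And>x y. \<sigma> (x + y) = \<sigma> x + \<sigma> y" and mult: "\<And>x y. \<sigma> (x * y) = \<sigma> x * \<sigma> y"
    using assms by (auto simp: embeddings_def)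
  have zero: "\<sigma> 0 = 0" using add[of 0 0] by simp
  have nat: "\<sigma> (of_nat k) = of_nat k" for k
    by (induction k) (auto simp: zero one add)
  have neg: "\<sigma> (- x) = - \<sigma> x" for x
    using add[of x "- x"] zero by (simp add: eq_neg_iff_add_eq_0 add.commute)
  have int: "\<sigma> (of_int k) = of_int k" for k
    by (cases k rule: int_cases2) (auto simp: nat neg)
  have "\<sigma> (of_rat q) = of_rat q" for q
  proof -
    obtain a b where q: "quotient_of q = (a, b)" by fastforce
    have b: "b \<noteq> 0" using quotient_of_denom_pos[OF q] by simp
    have "of_rat q * of_int b = (of_int a :: 'a)" "of_rat q * of_int b = (of_int a :: complex)"
      unfolding quotient_of_div[OF q] using b by (simp_all add: of_rat_divide)
    then have "\<sigma> (of_rat q) * of_int b = of_rat q * of_int b"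
      by (metis int mult)
    then show ?thesis using b by simp
  qed
  then show ?thesis
    by (simp add: rat_linear_def add mult)
qed

lemma embedding_power:
  assumes "\<sigma> \<in> embeddings"
  shows "\<sigma> (x ^ k) = \<sigma> x ^ k"
  using assms by (induction k) (auto simp: embeddings_def)

lemma embedding_poly:
  assumes "\<sigma> \<in> embeddings"
  shows "\<sigma> (poly (map_poly of_rat f) x) = poly (map_poly of_rat f) (\<sigma> x)"
  using embedding_rat_linear[OF assms]
  by (simp add: poly_altdef coeff_map_poly rat_linear_sum rat_linear_scale embedding_power[OF assms])

lemma embedding_algebraic_int:
  assumes "\<sigma> \<in> embeddings" "algebraic_int x"
  shows "algebraic_int (\<sigma> x)"
proof -
  obtain p where p: "poly (map_poly of_int p) x = 0" "lead_coeff p = 1"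
    using assms(2) unfolding algebraic_int_altdef_ipoly by blast
  have "\<sigma> (poly (map_poly of_int p) x) = poly (map_poly of_int p) (\<sigma> x)"
    using embedding_rat_linear[OF assms(1)]
    by (simp add: poly_altdef coeff_map_poly rat_linear_sum rat_linear_of_int embedding_power[OF assms(1)])
  with p show ?thesis
    unfolding algebraic_int_altdef_ipoly
    using rat_linear_zero[OF embedding_rat_linear[OF assms(1)]] by (intro exI[of _ p]) simp
qed

text \<open>
  The powers of \<open>x\<close> up to the degree of the field are either not distinct or linearly dependent.
\<close>

lemma number_field_algebraic:
  fixes x :: "'a::field_char_0"
  assumes "number_field TYPE('a)"
  obtains f :: "rat poly" where "f \<noteq> 0" "poly (map_poly of_rat f) x = 0"
proof -
  interpret hp: map_poly_comm_ring_hom "of_rat :: rat \<Rightarrow> 'a" ..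
  show ?thesis
  proof (cases "inj_on (\<lambda>k. x ^ k) {..field_degree TYPE('a)}")
    case False
    then obtain i j where ij: "i \<noteq> j" "x ^ i = x ^ j" by (auto simp: inj_on_def)
    have "coeff (monom 1 i - monom 1 j :: rat poly) i \<noteq> 0"
      using ij(1) by simp
    then have "monom 1 i - monom 1 j \<noteq> (0 :: rat poly)" by fastforce
    moreover have "poly (map_poly of_rat (monom 1 i - monom 1 j :: rat poly)) x = 0"
      using ij(2) by (simp add: hp.hom_minus map_poly_monom poly_monom)
    ultimately show ?thesis by (rule that)
  next
    case True
    let ?n = "field_degree TYPE('a)"
    let ?S = "(\<lambda>k. x ^ k) ` {..?n}"
    obtain B :: "'a set" where B: "finite B" "rat_scale.independent B" "rat_scale.span B = UNIV" "card B = ?n"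
      using number_field_basis[OF assms] by blast
    have "card ?S = Suc ?n" using True by (simp add: card_image)
    then have "rat_scale.dependent ?S"
      using rat_scale.independent_span_bound[OF B(1), of ?S] B(3,4) by auto
    then obtain u where u: "\<exists>v\<in>?S. u v \<noteq> 0" "(\<Sum>v\<in>?S. rat_scale (u v) v) = 0"
      using rat_scale.dependent_finite[of ?S] by auto
    define f where "f = (\<Sum>k\<le>?n. monom (u (x ^ k)) k)"
    have cf: "coeff f k = u (x ^ k)" if "k \<le> ?n" for k
      using that by (simp add: f_def coeff_sum)
    have "f \<noteq> 0"
      using u(1) cf by force
    moreover have "poly (map_poly of_rat f) x = (\<Sum>k\<le>?n. of_rat (u (x ^ k)) * x ^ k)"
      unfolding f_def by (simp add: hp.hom_sum map_poly_monom poly_sum poly_monom)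
    then have "poly (map_poly of_rat f) x = 0"
      using u(2) True by (simp add: sum.reindex rat_scale_def)
    ultimately show ?thesis by (rule that)
  qed
qed

text \<open>
  A polynomial \<open>f\<close> of least degree that kills \<open>x\<close> is coprime to its derivative, because a proper factor
  cannot kill \<open>x\<close>.  Over the complex numbers it is therefore a product of distinct linear factors.
\<close>

lemma number_field_roots:
  fixes x :: "'a::field_char_0"
  assumes "number_field TYPE('a)"
  obtains f :: "rat poly" and rs where "f \<noteq> 0" "poly (map_poly of_rat f) x = 0"
    "distinct rs" "set rs = {z. poly (map_poly of_rat f) z = 0}"
    "map_poly of_rat f = Polynomial.smult (of_rat (lead_coeff f)) (\<Prod>r\<leftarrow>rs. [:- r, 1 :: complex:])"
proof -
  interpret hK: map_poly_comm_ring_hom "of_rat :: rat \<Rightarrow> 'a" ..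
  interpret hC: map_poly_comm_ring_hom "of_rat :: rat \<Rightarrow> complex" ..
  define N where "N = (\<lambda>f :: rat poly. f \<noteq> 0 \<and> poly (map_poly of_rat f) x = 0)"
  define f where "f = arg_min degree N"
  have "\<exists>f. N f" using number_field_algebraic[OF assms] by (metis N_def)
  then have f: "N f" and min: "\<And>g. N g \<Longrightarrow> degree f \<le> degree g"
    using arg_min_nat_lemma[of N _ degree] by (auto simp: f_def)
  have f0: "f \<noteq> 0" and fx: "poly (map_poly of_rat f) x = 0" using f by (auto simp: N_def)
  have deg: "degree f > 0"
  proof (rule ccontr)
    assume "\<not> degree f > 0"
    then obtain a where "f = [:a:]" by (auto elim: degree_eq_zeroE)
    with f0 fx show False by simp
  qed
  define d where "d = gcd f (pderiv f)"
  obtain h where h: "f = d * h" using gcd_dvd1[of f "pderiv f"] unfolding d_def by (elim dvdE)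
  have d0: "d \<noteq> 0" and h0: "h \<noteq> 0" using f0 h by auto
  have "degree d \<le> degree (pderiv f)"
    using deg by (intro dvd_imp_degree_le) (auto simp: d_def pderiv_eq_0_iff)
  then have dlt: "degree d < degree f"
    using deg by (simp add: degree_pderiv)
  have "poly (map_poly of_rat d) x * poly (map_poly of_rat h) x = 0"
    using fx unfolding h by (simp add: hK.hom_mult)
  moreover have "poly (map_poly of_rat d) x \<noteq> 0"
    using min[of d] dlt d0 by (auto simp: N_def)
  ultimately have "N h" using h0 by (simp add: N_def)
  from min[OF this] have "degree d = 0"
    unfolding h using d0 h0 by (simp add: degree_mult_eq)
  then have "is_unit d" using d0 by (simp add: is_unit_iff_degree)
  then have "d = 1" unfolding d_def by (simp only: is_unit_gcd_iff)
  then obtain a b where ab: "a * f + b * pderiv f = 1"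
    using bezout_coefficients_fst_snd[of f "pderiv f"] by (auto simp: d_def)
  let ?F = "map_poly of_rat f :: complex poly"
  have "map_poly of_rat a * ?F + map_poly of_rat b * pderiv ?F = 1"
    using arg_cong[OF ab, of "map_poly (of_rat :: rat \<Rightarrow> complex)"]
    by (simp add: hC.hom_add hC.hom_mult of_rat_hom.map_poly_pderiv)
  then have "poly (map_poly of_rat a) z * poly ?F z + poly (map_poly of_rat b) z * poly (pderiv ?F) z = 1" for z
    by (metis poly_add poly_mult poly_1)
  then have "rsquarefree ?F"
    unfolding rsquarefree_roots by (metis add_0 mult_zero_right zero_neq_one)
  from complex_poly_decompose_rsquarefree[OF this]
  have eq: "Polynomial.smult (lead_coeff ?F) (\<Prod>z | poly ?F z = 0. [:- z, 1:]) = ?F" .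
  have "?F \<noteq> 0" using f0 by simp
  then have "finite {z. poly ?F z = 0}" by (rule poly_roots_finite)
  then obtain rs where rs: "set rs = {z. poly ?F z = 0}" "distinct rs"
    using finite_distinct_list by blast
  show ?thesis
  proof (rule that[OF f0 fx rs(2,1)])
    show "?F = Polynomial.smult (of_rat (lead_coeff f)) (\<Prod>r\<leftarrow>rs. [:- r, 1:])"
      using eq by (simp add: prod.distinct_set_conv_list[OF rs(2), symmetric] rs(1))
  qed
qed

section \<open>Decomposition of functionals into embeddings\<close>

text \<open>
  The field acts on its functionals by \<open>(x \<phi>) y = \<phi> (x * y)\<close>; this is the operator \<open>x - r\<close> for
  this action.
\<close>

definition shift_minus :: "'a::field_char_0 \<Rightarrow> complex \<Rightarrow> ('a \<Rightarrow> complex) \<Rightarrow> 'a \<Rightarrow> complex" where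
  "shift_minus x r \<phi> = (\<lambda>y. \<phi> (x * y) - r * \<phi> y)"

lemma foldr_shift_minus_linear:
  "foldr (shift_minus x) rs (\<lambda>y. \<phi> y - c * \<psi> y) =
     (\<lambda>y. foldr (shift_minus x) rs \<phi> y - c * foldr (shift_minus x) rs \<psi> y)"
  by (induction rs) (auto simp: shift_minus_def algebra_simps)

lemma degree_prod_list_linear: "degree (\<Prod>r\<leftarrow>rs. [:- r, 1 :: complex:]) = length rs"
proof (induction rs)
  case (Cons r rs)
  have "(\<Prod>r\<leftarrow>rs. [:- r, 1 :: complex:]) \<noteq> 0" by (auto simp: prod_list_zero_iff)
  then show ?case using Cons by (simp add: degree_mult_eq del: mult_pCons_left)
qed simp

text \<open>
  Composing the operators \<open>x - r\<close> is the action of the product polynomial at \<open>x\<close>.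
\<close>

lemma foldr_shift_minus_poly:
  "(\<Sum>k\<le>length rs. coeff (\<Prod>r\<leftarrow>rs. [:- r, 1:]) k * \<phi> (x ^ k * y)) = foldr (shift_minus x) rs \<phi> y"
proof (induction rs arbitrary: y)
  case Nil
  then show ?case by simp
next
  case (Cons r rs)
  let ?p = "\<Prod>r\<leftarrow>rs. [:- r, 1:]"
  have deg: "degree ?p \<le> length rs"
    by (simp add: degree_prod_list_linear)
  have "(\<Prod>r\<leftarrow>r # rs. [:- r, 1:]) = pCons 0 ?p - Polynomial.smult r ?p"
    by simp
  then have "(\<Sum>k\<le>length (r # rs). coeff (\<Prod>r\<leftarrow>r # rs. [:- r, 1:]) k * \<phi> (x ^ k * y)) =
      (\<Sum>k\<le>Suc (length rs). coeff (pCons 0 ?p) k * \<phi> (x ^ k * y)) -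
      r * (\<Sum>k\<le>Suc (length rs). coeff ?p k * \<phi> (x ^ k * y))"
    by (simp add: algebra_simps sum_subtractf sum_distrib_left del: sum.atMost_Suc)
  also have "(\<Sum>k\<le>Suc (length rs). coeff (pCons 0 ?p) k * \<phi> (x ^ k * y)) =
      (\<Sum>k\<le>length rs. coeff ?p k * \<phi> (x ^ k * (x * y)))"
    unfolding sum.atMost_Suc_shift by (simp add: algebra_simps)
  also have "(\<Sum>k\<le>Suc (length rs). coeff ?p k * \<phi> (x ^ k * y)) = (\<Sum>k\<le>length rs. coeff ?p k * \<phi> (x ^ k * y))"
    using deg by (simp add: coeff_eq_0)
  finally show ?case
    by (simp add: Cons.IH shift_minus_def)
qed

text \<open>
  Algebraic values are carried along because the coefficients of embeddings in a functional must have
  a denominator: this is what bounds the values of the functional on algebraic integers.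
\<close>

definition alg_functional :: "('a::field_char_0 \<Rightarrow> complex) \<Rightarrow> bool" where
  "alg_functional \<phi> \<longleftrightarrow> rat_linear \<phi> \<and> (\<forall>y. algebraic (\<phi> y))"

text \<open>
  A simultaneous eigenvector of the elements of \<open>B\<close>, with eigenvalues \<open>l\<close>.  When \<open>B\<close> is a basis of the
  field, such a functional is a multiple of a complex embedding.
\<close>

definition eigenfunctional :: "'a::field_char_0 set \<Rightarrow> ('a \<Rightarrow> complex) \<Rightarrow> ('a \<Rightarrow> complex) \<Rightarrow> bool" where
  "eigenfunctional B l \<phi> \<longleftrightarrow> alg_functional \<phi> \<and> (\<forall>b\<in>B. \<forall>y. \<phi> (b * y) = l b * \<phi> y)"

lemma eigenfunctional_combination:
  assumes "eigenfunctional B l \<phi>" "eigenfunctional B l \<psi>" "algebraic c"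
  shows "eigenfunctional B l (\<lambda>y. \<phi> y - c * \<psi> y)"
proof -
  have "algebraic (\<phi> y - c * \<psi> y)" for y
    using assms algebraic_add[of "\<phi> y" "- (c * \<psi> y)"] algebraic_mult[of c "\<psi> y"]
    by (auto simp: eigenfunctional_def alg_functional_def)
  then show ?thesis
    using assms by (auto simp: eigenfunctional_def alg_functional_def rat_linear_def algebra_simps)
qed

lemma eigenfunctional_shift_minus:
  assumes "eigenfunctional B l \<phi>" "algebraic r"
  shows "eigenfunctional B l (shift_minus x r \<phi>)"
proof -
  have "\<phi> (x * (c * y)) = \<phi> (c * (x * y))" for c y by (simp add: mult.left_commute)
  then have "eigenfunctional B l (\<lambda>y. \<phi> (x * y))"
    using assms(1)
    by (auto simp: eigenfunctional_def alg_functional_def rat_linear_def distrib_left)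
  from eigenfunctional_combination[OF this assms] show ?thesis
    by (simp add: shift_minus_def)
qed

inductive_set sums_of :: "('a \<Rightarrow> complex) set \<Rightarrow> ('a \<Rightarrow> complex) set" for G where
  zero: "(\<lambda>y. 0) \<in> sums_of G"
| add: "\<psi> \<in> G \<Longrightarrow> \<phi> \<in> sums_of G \<Longrightarrow> (\<lambda>y. \<psi> y + \<phi> y) \<in> sums_of G"

lemma sums_of_base: "\<psi> \<in> G \<Longrightarrow> \<psi> \<in> sums_of G"
  using sums_of.add[OF _ sums_of.zero, of \<psi> G] by simp

lemma sums_of_add:
  assumes "\<phi> \<in> sums_of G" "\<psi> \<in> sums_of G"
  shows "(\<lambda>y. \<phi> y + \<psi> y) \<in> sums_of G"
  using assms(1)
proof induction
  case zero
  then show ?case using assms(2) by simp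
next
  case (add \<eta> \<phi>)
  then show ?case using sums_of.add[OF add(1,3)] by (simp add: add.assoc)
qed

lemma sums_of_trans:
  assumes "\<phi> \<in> sums_of G" "\<And>\<psi>. \<psi> \<in> G \<Longrightarrow> \<psi> \<in> sums_of H"
  shows "\<phi> \<in> sums_of H"
  using assms(1) by induction (auto intro: sums_of.zero sums_of_add assms(2))

text \<open>
  Partial fractions without denominators.  Let \<open>h\<close> be the product of the \<open>x - s\<close> for the roots \<open>s\<close>
  other than \<open>r\<close>.  Then \<open>h \<phi>\<close> is an eigenvector for \<open>r\<close>, on which \<open>h\<close> acts by the nonzero number
  \<open>c = h(r)\<close>, so subtracting \<open>h \<phi> / c\<close> from \<open>\<phi>\<close> leaves a functional that is killed by \<open>h\<close>.
\<close>

lemma eigenfunctional_split: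
  assumes "eigenfunctional B l \<phi>" "distinct rs" "\<And>r. r \<in> set rs \<Longrightarrow> algebraic r"
    and "\<And>y. foldr (shift_minus x) rs \<phi> y = 0"
  shows "\<phi> \<in> sums_of {\<psi>. eigenfunctional B l \<psi> \<and> (\<exists>r. \<forall>y. \<psi> (x * y) = r * \<psi> y)}"
  using assms
proof (induction rs arbitrary: \<phi>)
  case Nil
  then have "\<phi> = (\<lambda>y. 0)" by auto
  then show ?case by (simp add: sums_of.zero)
next
  case (Cons r rs)
  define \<psi> where "\<psi> = foldr (shift_minus x) rs \<phi>"
  define c where "c = (\<Prod>s\<leftarrow>rs. r - s)"
  have c0: "c \<noteq> 0" using Cons.prems(2) by (auto simp: c_def prod_list_zero_iff)
  have "algebraic c"
    using Cons.prems(3) unfolding c_def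
  proof (induction rs)
    case (Cons s rs)
    have "algebraic (r - s)"
      using algebraic_add[of r "- s"] Cons.prems by simp
    with Cons show ?case by (auto intro!: algebraic_mult)
  qed simp
  then have ac: "algebraic (inverse c)" by (rule algebraic_inverse)
  have \<psi>x: "\<psi> (x * y) = r * \<psi> y" for y
  proof -
    have "shift_minus x r \<psi> y = 0" using Cons.prems(4)[of y] by (simp add: \<psi>_def)
    then show ?thesis by (simp add: shift_minus_def)
  qed
  have "eigenfunctional B l (foldr (shift_minus x) ss \<phi>)" if "set ss \<subseteq> set rs" for ss
    using that by (induction ss) (auto intro!: eigenfunctional_shift_minus Cons.prems)
  then have \<psi>e: "eigenfunctional B l \<psi>" by (simp add: \<psi>_def)
  have "foldr (shift_minus x) ss \<psi> = (\<lambda>y. (\<Prod>s\<leftarrow>ss. r - s) * \<psi> y)" for ss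
    by (induction ss) (auto simp: shift_minus_def \<psi>x left_diff_distrib mult.assoc mult.left_commute)
  then have fold_\<psi>: "foldr (shift_minus x) rs \<psi> = (\<lambda>y. c * \<psi> y)" by (simp add: c_def)
  define \<phi>' where "\<phi>' = (\<lambda>y. \<phi> y - inverse c * \<psi> y)"
  have "\<phi>' \<in> sums_of {\<psi>. eigenfunctional B l \<psi> \<and> (\<exists>r. \<forall>y. \<psi> (x * y) = r * \<psi> y)}"
  proof (rule Cons.IH)
    show "eigenfunctional B l \<phi>'"
      unfolding \<phi>'_def using Cons.prems(1) \<psi>e ac by (rule eigenfunctional_combination)
    show "foldr (shift_minus x) rs \<phi>' y = 0" for y
      unfolding \<phi>'_def foldr_shift_minus_linear fold_\<psi> using c0 by (simp add: \<psi>_def)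
  qed (use Cons.prems in auto)
  moreover have "(\<lambda>y. inverse c * \<psi> y) \<in> {\<psi>. eigenfunctional B l \<psi> \<and> (\<exists>r. \<forall>y. \<psi> (x * y) = r * \<psi> y)}"
    using eigenfunctional_combination[OF _ \<psi>e algebraic_minus[OF ac], of "\<lambda>y. 0"] \<psi>x
    by (auto simp: eigenfunctional_def alg_functional_def rat_linear_def)
  ultimately have "(\<lambda>y. inverse c * \<psi> y + \<phi>' y) \<in> sums_of {\<psi>. eigenfunctional B l \<psi> \<and> (\<exists>r. \<forall>y. \<psi> (x * y) = r * \<psi> y)}"
    by (intro sums_of.add)
  then show ?case by (simp add: \<phi>'_def)
qed

text \<open>
  The operators \<open>x - r\<close> commute with the action of \<open>B\<close>, so the splitting for one more element \<open>x\<close>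
  respects the eigenvectors that were already found.
\<close>

lemma alg_functional_eigen_decomposition:
  fixes B :: "'a::field_char_0 set"
  assumes K: "number_field TYPE('a)" and "finite B" and "alg_functional \<phi>"
  shows "\<phi> \<in> sums_of {\<psi>. \<exists>l. eigenfunctional B l \<psi>}"
  using assms(2)
proof (induction B)
  case empty
  then show ?case using assms(3) by (intro sums_of_base) (simp add: eigenfunctional_def)
next
  case (insert x B)
  have "\<psi> \<in> sums_of {\<psi>. \<exists>l. eigenfunctional (insert x B) l \<psi>}" if \<psi>: "eigenfunctional B l \<psi>" for \<psi> l
  proof -
    obtain f rs where f: "f \<noteq> 0" "poly (map_poly of_rat f) x = 0"
      "distinct rs" "set rs = {z. poly (map_poly of_rat f) z = 0}"
      "map_poly of_rat f = Polynomial.smult (of_rat (lead_coeff f)) (\<Prod>r\<leftarrow>rs. [:- r, 1 :: complex:])"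
      using number_field_roots[OF K] by blast
    let ?p = "\<Prod>r\<leftarrow>rs. [:- r, 1 :: complex:]"
    have lin: "rat_linear \<psi>" using \<psi> by (simp add: eigenfunctional_def alg_functional_def)
    have deg: "degree f = length rs"
    proof -
      have "degree f = degree (map_poly of_rat f :: complex poly)" by simp
      also have "\<dots> = degree ?p" unfolding f(5) using f(1) by simp
      also have "\<dots> = length rs" by (rule degree_prod_list_linear)
      finally show ?thesis .
    qed
    have alg: "algebraic r" if "r \<in> set rs" for r
      using that f(1,4) by (intro algebraicI'[of "map_poly of_rat f"]) (auto simp: coeff_map_poly)
    have zero: "foldr (shift_minus x) rs \<psi> y = 0" for y
    proof -
      have "0 = \<psi> (poly (map_poly of_rat f) x * y)"
        using f(2) rat_linear_zero[OF lin] by simp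
      also have "\<dots> = (\<Sum>k\<le>length rs. of_rat (coeff f k) * \<psi> (x ^ k * y))"
        by (simp add: poly_altdef coeff_map_poly deg sum_distrib_right rat_linear_sum[OF lin]
            mult.assoc rat_linear_scale[OF lin])
      also have "\<dots> = (\<Sum>k\<le>length rs. of_rat (lead_coeff f) * (coeff ?p k * \<psi> (x ^ k * y)))"
      proof (rule sum.cong[OF refl])
        fix k
        have "of_rat (coeff f k) = of_rat (lead_coeff f) * coeff ?p k"
          using arg_cong[OF f(5), of "\<lambda>p. coeff p k"] by (simp add: coeff_map_poly)
        then show "of_rat (coeff f k) * \<psi> (x ^ k * y) = of_rat (lead_coeff f) * (coeff ?p k * \<psi> (x ^ k * y))"
          by simp
      qed
      also have "\<dots> = of_rat (lead_coeff f) * foldr (shift_minus x) rs \<psi> y"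
        by (simp add: foldr_shift_minus_poly flip: sum_distrib_left)
      finally show ?thesis using f(1) by simp
    qed
    have "\<psi> \<in> sums_of {\<psi>. eigenfunctional B l \<psi> \<and> (\<exists>r. \<forall>y. \<psi> (x * y) = r * \<psi> y)}"
      by (rule eigenfunctional_split[OF \<psi> f(3) alg zero])
    then show ?thesis
    proof (rule sums_of_trans)
      fix \<eta> assume "\<eta> \<in> {\<psi>. eigenfunctional B l \<psi> \<and> (\<exists>r. \<forall>y. \<psi> (x * y) = r * \<psi> y)}"
      then obtain r where "eigenfunctional B l \<eta>" "\<And>y. \<eta> (x * y) = r * \<eta> y" by auto
      then have "eigenfunctional (insert x B) (l(x := r)) \<eta>"
        using insert.hyps by (auto simp: eigenfunctional_def)
      then show "\<eta> \<in> sums_of {\<psi>. \<exists>l. eigenfunctional (insert x B) l \<psi>}"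
        by (intro sums_of_base) blast
    qed
  qed
  then show ?case
    by (intro sums_of_trans[OF insert.IH]) auto
qed

text \<open>
  Embeddings span the dual space.  A simultaneous eigenvector \<open>\<psi>\<close> for a basis satisfies
  \<open>\<psi> (x * y) = \<mu> x * \<psi> y\<close>, so it vanishes if \<open>\<psi> 1 = 0\<close>, and otherwise \<open>\<psi> / \<psi> 1\<close> is multiplicative.
\<close>

theorem alg_functional_sum_of_embeddings:
  fixes \<phi> :: "'a::field_char_0 \<Rightarrow> complex"
  assumes K: "number_field TYPE('a)" and \<phi>: "alg_functional \<phi>"
  shows "\<phi> \<in> sums_of {\<lambda>y. c * \<sigma> y | c \<sigma>. algebraic c \<and> \<sigma> \<in> embeddings}" (is "_ \<in> sums_of ?E")
proof -
  obtain B :: "'a set" where B: "finite B" "rat_scale.independent B" "rat_scale.span B = UNIV"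
    by (rule number_field_basis[OF K])
  show ?thesis
  proof (rule sums_of_trans[OF alg_functional_eigen_decomposition[OF K B(1) \<phi>]])
    fix \<psi> :: "'a \<Rightarrow> complex" assume "\<psi> \<in> {\<psi>. \<exists>l. eigenfunctional B l \<psi>}"
    then obtain l where \<psi>: "eigenfunctional B l \<psi>" by blast
    then have lin: "rat_linear \<psi>" and alg: "\<And>y. algebraic (\<psi> y)"
      and ev: "\<And>b y. b \<in> B \<Longrightarrow> \<psi> (b * y) = l b * \<psi> y"
      by (auto simp: eigenfunctional_def alg_functional_def)
    define \<mu> where "\<mu> = (\<lambda>x. \<Sum>b\<in>B. of_rat (rat_scale.representation B x b) * l b)"
    have mult: "\<psi> (x * y) = \<mu> x * \<psi> y" for x y
    proof -
      have "\<psi> (x * y) = \<psi> ((\<Sum>b\<in>B. of_rat (rat_scale.representation B x b) * b) * y)"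
        by (simp add: sum_representation[OF B(2,3,1)])
      also have "\<dots> = \<mu> x * \<psi> y"
        by (simp add: \<mu>_def sum_distrib_right rat_linear_sum[OF lin] mult.assoc
            rat_linear_scale[OF lin] ev)
      finally show ?thesis .
    qed
    have val: "\<psi> x = \<mu> x * \<psi> 1" for x using mult[of x 1] by simp
    show "\<psi> \<in> sums_of ?E"
    proof (cases "\<psi> 1 = 0")
      case True
      then have "\<psi> y = 0" for y using val[of y] by simp
      then have "\<psi> = (\<lambda>y. 0)" by (intro ext)
      then show ?thesis by (simp add: sums_of.zero)
    next
      case False
      define \<sigma> where "\<sigma> = (\<lambda>x. \<psi> x / \<psi> 1)"
      have "\<sigma> x = \<mu> x" for x using False val[of x] by (simp add: \<sigma>_def)
      then have "\<sigma> (x * y) = \<sigma> x * \<sigma> y" for x y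
        using mult[of x y] by (metis \<sigma>_def times_divide_eq_right)
      then have "\<sigma> \<in> embeddings"
        using False by (simp add: embeddings_def \<sigma>_def rat_linear_add[OF lin] add_divide_distrib)
      moreover have "\<psi> = (\<lambda>y. \<psi> 1 * \<sigma> y)" using False by (simp add: \<sigma>_def)
      ultimately show ?thesis using alg by (intro sums_of_base) blast
    qed
  qed
qed

section \<open>Denominators of functionals and the number of embeddings\<close>

text \<open>
  On an algebraic integer \<open>x\<close>, a combination of embeddings with algebraic coefficients becomes an
  algebraic integer after multiplication by a common denominator of the coefficients.  If the value is
  rational, it becomes an integer.  This replaces the usual argument with the discriminant, and is the
  source of all finiteness properties of the ring of integers below.
\<close>

lemma rational_functional_denominator:
  fixes \<phi> :: "'a::field_char_0 \<Rightarrow> rat"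
  assumes K: "number_field TYPE('a)" and \<phi>: "rat_linear \<phi>"
  obtains m :: nat where "m > 0" "\<And>x. algebraic_int x \<Longrightarrow> of_nat m * \<phi> x \<in> \<int>"
proof -
  have "alg_functional (\<lambda>x. of_rat (\<phi> x))"
    using \<phi> by (auto simp: alg_functional_def rat_linear_def of_rat_add of_rat_mult rat_imp_algebraic)
  from alg_functional_sum_of_embeddings[OF K this]
  have "\<exists>m>0. \<forall>x. algebraic_int x \<longrightarrow> algebraic_int (of_nat m * of_rat (\<phi> x) :: complex)"
  proof induction
    case zero
    then show ?case by (auto intro: exI[of _ 1])
  next
    case (add \<psi> \<phi>)
    then obtain c \<sigma> where \<psi>: "\<psi> = (\<lambda>y. c * \<sigma> y)" and c: "algebraic c" and \<sigma>: "\<sigma> \<in> embeddings" by auto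
    from add.IH obtain m where m: "m > 0" "\<And>x. algebraic_int x \<Longrightarrow> algebraic_int (of_nat m * \<phi> x)"
      by blast
    obtain k where k: "k > 0" "algebraic_int (of_nat k * c)"
      using algebraic_imp_multiple_int[OF c] by blast
    have "algebraic_int (of_nat (m * k) * (\<psi> x + \<phi> x))" if x: "algebraic_int x" for x
    proof -
      have "algebraic_int (of_nat m * ((of_nat k * c) * \<sigma> x) + of_nat k * (of_nat m * \<phi> x))"
        by (intro algebraic_int_add algebraic_int_mult[OF algebraic_int_of_nat]
            algebraic_int_mult[OF k(2)] embedding_algebraic_int[OF \<sigma>] m(2) x)
      then show ?thesis by (simp add: \<psi> algebra_simps)
    qed
    then show ?case using m(1) k(1) by (intro exI[of _ "m * k"]) simp
  qed
  then obtain m where m: "m > 0"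
    "\<And>x. algebraic_int x \<Longrightarrow> algebraic_int (of_nat m * of_rat (\<phi> x) :: complex)" by blast
  have "of_nat m * \<phi> x \<in> \<int>" if "algebraic_int x" for x
  proof -
    have eq: "of_nat m * of_rat (\<phi> x) = (of_rat (of_nat m * \<phi> x) :: complex)"
      by (simp add: of_rat_mult)
    have "of_rat (of_nat m * \<phi> x) \<in> (\<int> :: complex set)"
      using rational_algebraic_int_is_int[OF m(2)[OF that]] by (simp only: eq Rats_of_rat)
    then obtain k where "of_rat (of_nat m * \<phi> x) = (of_int k :: complex)" by (elim Ints_cases)
    then have "of_rat (of_nat m * \<phi> x) = (of_rat (of_int k) :: complex)" by simp
    then have "of_nat m * \<phi> x = of_int k" by (simp only: of_rat_eq_iff)
    then show ?thesis by simp
  qed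
  with m(1) show ?thesis by (rule that)
qed

text \<open>
  An embedding is determined by the images of a basis, and each image is a root of a fixed polynomial.
\<close>

lemma finite_embeddings:
  assumes K: "number_field TYPE('a::field_char_0)"
  shows "finite (embeddings :: ('a \<Rightarrow> complex) set)"
proof -
  obtain B :: "'a set" where B: "finite B" "rat_scale.independent B" "rat_scale.span B = UNIV"
    by (rule number_field_basis[OF K])
  have "\<exists>R. finite R \<and> (\<forall>\<sigma>\<in>embeddings. \<sigma> b \<in> R)" for b :: 'a
  proof -
    obtain f where f: "f \<noteq> 0" "poly (map_poly of_rat f) b = 0"
      by (rule number_field_algebraic[OF K])
    have "poly (map_poly of_rat f) (\<sigma> b) = 0" if "\<sigma> \<in> embeddings" for \<sigma> :: "'a \<Rightarrow> complex"
      using embedding_poly[OF that, of f b] f(2) rat_linear_zero[OF embedding_rat_linear[OF that]] by simp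
    moreover have "finite {z. poly (map_poly of_rat f :: complex poly) z = 0}"
      using f(1) by (intro poly_roots_finite) simp
    ultimately show ?thesis by blast
  qed
  then obtain R where R: "\<And>b :: 'a. finite (R b)" "\<And>b \<sigma>. \<sigma> \<in> embeddings \<Longrightarrow> \<sigma> b \<in> R b"
    by metis
  have "inj_on (\<lambda>\<sigma>. restrict \<sigma> B) (embeddings :: ('a \<Rightarrow> complex) set)"
  proof (rule inj_onI, rule ext)
    fix \<sigma> \<tau> :: "'a \<Rightarrow> complex" and x
    assume \<sigma>: "\<sigma> \<in> embeddings" and \<tau>: "\<tau> \<in> embeddings" and eq: "restrict \<sigma> B = restrict \<tau> B"
    have eqB: "\<sigma> b = \<tau> b" if "b \<in> B" for b using fun_cong[OF eq, of b] that by simp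
    have "\<sigma> (\<Sum>b\<in>B. of_rat (rat_scale.representation B x b) * b) =
        \<tau> (\<Sum>b\<in>B. of_rat (rat_scale.representation B x b) * b)"
      by (simp add: rat_linear_sum rat_linear_scale embedding_rat_linear[OF \<sigma>] embedding_rat_linear[OF \<tau>] eqB)
    then show "\<sigma> x = \<tau> x" by (simp add: sum_representation[OF B(2,3,1)])
  qed
  moreover have "(\<lambda>\<sigma>. restrict \<sigma> B) ` embeddings \<subseteq> PiE B R"
    using R(2) by auto
  moreover have "finite (PiE B R)" using B(1) R(1) by (intro finite_PiE)
  ultimately show ?thesis by (meson finite_imageD finite_subset)
qed

text \<open>
  The coordinate functionals of a basis are linearly independent over the complex numbers and lie in
  the span of the embeddings.
\<close>

theorem field_degree_le_card_embeddings:
  assumes K: "number_field TYPE('a::field_char_0)"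
  shows "field_degree TYPE('a) \<le> card (embeddings :: ('a \<Rightarrow> complex) set)"
proof -
  interpret fs: vector_space "\<lambda>(c::complex) (f :: 'a \<Rightarrow> complex) x. c * f x"
    by unfold_locales (auto simp: algebra_simps)
  obtain B :: "'a set" where B: "finite B" "rat_scale.independent B" "rat_scale.span B = UNIV"
    "card B = field_degree TYPE('a)"
    by (rule number_field_basis[OF K])
  define \<phi> where "\<phi> = (\<lambda>b x. of_rat (rat_scale.representation B x b) :: complex)"
  have dual: "\<phi> b c = (if b = c then 1 else 0)" if "c \<in> B" for b c
    using that by (auto simp: \<phi>_def rat_scale.representation_basis[OF B(2)])
  have inj: "inj_on \<phi> B"
  proof (rule inj_onI)
    fix b c assume "b \<in> B" "c \<in> B" "\<phi> b = \<phi> c"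
    then show "b = c" using dual[of c b] dual[of c c] by (auto split: if_splits)
  qed
  have "alg_functional (\<phi> b)" for b
    using rat_linear_representation[OF B(2,3), of b]
    by (auto simp: \<phi>_def alg_functional_def rat_linear_def of_rat_add of_rat_mult rat_imp_algebraic)
  then have "\<phi> b \<in> sums_of {\<lambda>y. c * \<sigma> y | c \<sigma>. algebraic c \<and> \<sigma> \<in> embeddings}" for b
    by (rule alg_functional_sum_of_embeddings[OF K])
  then have "\<phi> b \<in> fs.span embeddings" for b
  proof (rule sums_of.induct)
    show "(\<lambda>y. 0) \<in> fs.span embeddings"
      using fs.span_zero by (simp add: zero_fun_def)
    fix \<psi> \<eta> :: "'a \<Rightarrow> complex"
    assume "\<psi> \<in> {\<lambda>y. c * \<sigma> y | c \<sigma>. algebraic c \<and> \<sigma> \<in> embeddings}" and \<eta>: "\<eta> \<in> fs.span embeddings"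
    then have "\<psi> \<in> fs.span embeddings" by (auto intro: fs.span_scale fs.span_base)
    from fs.span_add[OF this \<eta>] show "(\<lambda>y. \<psi> y + \<eta> y) \<in> fs.span embeddings"
      by (simp add: plus_fun_def)
  qed
  then have sub: "\<phi> ` B \<subseteq> fs.span embeddings" by auto
  have "fs.independent (\<phi> ` B)"
  proof (rule fs.independent_if_scalars_zero)
    fix u f assume eq: "(\<Sum>g\<in>\<phi> ` B. (\<lambda>x. u g * g x)) = 0" and "f \<in> \<phi> ` B"
    then obtain c where c: "c \<in> B" "f = \<phi> c" by auto
    have ev: "(\<Sum>g\<in>S. h g) x = (\<Sum>g\<in>S. h g x)" if "finite S" for S and h :: "('a \<Rightarrow> complex) \<Rightarrow> 'a \<Rightarrow> complex" and x
      using that by induction auto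
    have "0 = (\<Sum>g\<in>\<phi> ` B. u g * g c)"
      using fun_cong[OF eq, of c] ev[of "\<phi> ` B" "\<lambda>g x. u g * g x" c] B(1) by simp
    also have "\<dots> = (\<Sum>b\<in>B. u (\<phi> b) * (if b = c then 1 else 0))"
      using inj c by (simp add: sum.reindex dual)
    also have "\<dots> = u f" using B(1) c by (simp add: mult_delta_right)
    finally show "u f = 0" by simp
  qed (use B in auto)
  from fs.independent_span_bound[OF finite_embeddings[OF K] this sub]
  show ?thesis using inj B(4) by (simp add: card_image)
qed

section \<open>The ring of integers and its ideals\<close>

lemma ring_of_integers_simps [simp]:
  "carrier ring_of_integers = {x :: 'a::field_char_0. algebraic_int x}"
  "x \<otimes>\<^bsub>ring_of_integers\<^esub> y = x * (y :: 'a)"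
  "x \<oplus>\<^bsub>ring_of_integers\<^esub> y = x + (y :: 'a)"
  "\<one>\<^bsub>ring_of_integers\<^esub> = (1 :: 'a)"
  "\<zero>\<^bsub>ring_of_integers\<^esub> = (0 :: 'a)"
  by (simp_all add: ring_of_integers_def)

lemma ring_of_integers_cring: "cring (ring_of_integers :: 'a::field_char_0 ring)"
proof (rule cringI)
  show "abelian_group (ring_of_integers :: 'a ring)"
  proof (rule abelian_groupI)
    fix x :: 'a assume "x \<in> carrier ring_of_integers"
    then show "\<exists>y\<in>carrier ring_of_integers. y \<oplus>\<^bsub>ring_of_integers\<^esub> x = \<zero>\<^bsub>ring_of_integers\<^esub>"
      by (intro bexI[of _ "- x"]) auto
  qed (auto simp: algebraic_int_add)
  show "comm_monoid (ring_of_integers :: 'a ring)"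
    by (rule comm_monoidI) (auto simp: algebraic_int_mult)
qed (auto simp: distrib_right)

interpretation ring_of_integers: cring "ring_of_integers :: 'a::field_char_0 ring"
  by (rule ring_of_integers_cring)

lemma ideal_ring_of_integers_iff:
  fixes I :: "'a::field_char_0 set"
  shows "ideal I ring_of_integers \<longleftrightarrow> (\<forall>x\<in>I. algebraic_int x) \<and> 0 \<in> I \<and> (\<forall>x\<in>I. \<forall>y\<in>I. x + y \<in> I) \<and>
    (\<forall>r x. algebraic_int r \<longrightarrow> x \<in> I \<longrightarrow> r * x \<in> I)" (is "_ \<longleftrightarrow> ?R")
proof
  assume "ideal I ring_of_integers"
  then interpret ideal I "ring_of_integers" .
  show ?R
    using a_subset a_closed zero_closed I_l_closed by auto
next
  assume R: ?R
  have neg: "- x \<in> I" if "x \<in> I" for x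
    using R that by (metis algebraic_int_1 algebraic_int_minus mult_minus_left mult_1)
  have inv: "inv\<^bsub>add_monoid ring_of_integers\<^esub> x = - x" if "algebraic_int x" for x :: 'a
  proof -
    have "(- x) \<oplus>\<^bsub>ring_of_integers\<^esub> x = \<zero>\<^bsub>ring_of_integers\<^esub>" by simp
    from ring_of_integers.minus_equality[OF this] that show ?thesis
      by (simp add: a_inv_def)
  qed
  show "ideal I ring_of_integers"
  proof (rule idealI)
    show "subgroup I (add_monoid (ring_of_integers :: 'a ring))"
      using R neg inv by (intro subgroup.intro) auto
    show "x \<otimes>\<^bsub>ring_of_integers\<^esub> a \<in> I" "a \<otimes>\<^bsub>ring_of_integers\<^esub> x \<in> I"
      if "a \<in> I" "x \<in> carrier ring_of_integers" for a x
      using R that by (simp_all add: mult.commute[of a x])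
  qed (rule ring_of_integers.ring_axioms)
qed

lemma ideal_algebraic_int: "ideal I ring_of_integers \<Longrightarrow> x \<in> I \<Longrightarrow> algebraic_int x"
  and ideal_zero: "ideal I ring_of_integers \<Longrightarrow> 0 \<in> I"
  and ideal_add: "ideal I ring_of_integers \<Longrightarrow> x \<in> I \<Longrightarrow> y \<in> I \<Longrightarrow> x + y \<in> I"
  and ideal_mult: "ideal I ring_of_integers \<Longrightarrow> algebraic_int r \<Longrightarrow> x \<in> I \<Longrightarrow> r * x \<in> I"
  for I :: "'a::field_char_0 set"
  by (simp_all add: ideal_ring_of_integers_iff)

lemma ideal_diff: "ideal I ring_of_integers \<Longrightarrow> x \<in> I \<Longrightarrow> y \<in> I \<Longrightarrow> x - y \<in> I"
  for I :: "'a::field_char_0 set"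
  using ideal_add[of I x "- y"] ideal_mult[of I "-1" y] by simp

lemma ideal_eq_integers_iff:
  fixes I :: "'a::field_char_0 set"
  assumes "ideal I ring_of_integers"
  shows "carrier ring_of_integers = I \<longleftrightarrow> 1 \<in> I"
  using ideal_mult[OF assms, of _ 1] ideal_algebraic_int[OF assms] by auto

text \<open>
  With respect to a rational basis, the coordinates of algebraic integers have bounded denominators
  \<open>m\<close>, and each basis element \<open>b\<close> has an integral multiple \<open>k b\<close>.  Two algebraic integers whose scaled
  coordinates agree modulo \<open>m k N\<close> therefore differ by an integral multiple of \<open>N\<close>.
\<close>

lemma finite_residues:
  assumes K: "number_field TYPE('a::field_char_0)" and N: "N > (0::nat)"
  obtains T :: "'a::field_char_0 set" where "finite T" "\<And>t. t \<in> T \<Longrightarrow> algebraic_int t"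
    "\<And>x. algebraic_int x \<Longrightarrow> \<exists>t\<in>T. algebraic_int ((x - t) / of_nat N)"
proof -
  obtain B :: "'a set" where B: "finite B" "rat_scale.independent B" "rat_scale.span B = UNIV"
    by (rule number_field_basis[OF K])
  let ?\<phi> = "\<lambda>b x. rat_scale.representation B x b"
  have "\<exists>m>0. \<forall>x. algebraic_int x \<longrightarrow> of_nat m * ?\<phi> b x \<in> \<int>" for b
    using rational_functional_denominator[OF K rat_linear_representation[OF B(2,3), of b]] by metis
  then obtain m :: "'a \<Rightarrow> nat" where m: "\<And>b. m b > 0"
    "\<And>b x. algebraic_int x \<Longrightarrow> of_nat (m b) * ?\<phi> b x \<in> \<int>" by metis
  have "\<exists>k>0. algebraic_int (of_nat k * b)" for b :: 'a
  proof -
    obtain f where "f \<noteq> 0" "poly (map_poly of_rat f) b = 0"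
      by (rule number_field_algebraic[OF K])
    then have "algebraic b" by (intro algebraicI'[of "map_poly of_rat f"]) (auto simp: coeff_map_poly)
    then show ?thesis by (metis algebraic_imp_multiple_int)
  qed
  then obtain k :: "'a \<Rightarrow> nat" where k: "\<And>b. k b > 0" "\<And>b. algebraic_int (of_nat (k b) * b)" by metis
  \<comment> \<open>One modulus for each basis element: the product of the two denominators and \<open>N\<close>.\<close>
  define d where "d = (\<lambda>b. m b * k b * N)"
  define c where "c = (\<lambda>x. \<lambda>b\<in>B. \<lfloor>of_nat (m b) * ?\<phi> b x\<rfloor> mod int (d b))"
  have "c ` {x. algebraic_int x} \<subseteq> (PiE B (\<lambda>b. {0..<int (d b)}))"
    using m(1) k(1) N by (auto simp: c_def d_def)
  moreover have "finite (PiE B (\<lambda>b. {0..<int (d b)}))" using B(1) by (intro finite_PiE) auto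
  ultimately have "finite (c ` {x. algebraic_int x})" by (rule finite_subset)
  from finite_subset_image[OF this order_refl] obtain T where T: "T \<subseteq> {x. algebraic_int x}" "finite T"
    "c ` {x. algebraic_int x} = c ` T" by blast
  have "\<exists>t\<in>T. algebraic_int ((x - t) / of_nat N)" if x: "algebraic_int x" for x
  proof -
    from T(3) x obtain t where t: "t \<in> T" "c x = c t" by blast
    have ti: "algebraic_int t" using t T(1) by auto
    have "\<exists>j. ?\<phi> b x - ?\<phi> b t = of_nat (k b * N) * of_int j" if b: "b \<in> B" for b
    proof -
      obtain u v where u: "of_nat (m b) * ?\<phi> b x = of_int u" and v: "of_nat (m b) * ?\<phi> b t = of_int v"
        using m(2)[OF x] m(2)[OF ti] by (meson Ints_cases)
      have "u mod int (d b) = v mod int (d b)"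
        using fun_cong[OF t(2), of b] b by (simp add: c_def u v)
      then obtain j where j: "u - v = int (d b) * j" by (metis mod_eq_dvd_iff dvdE)
      have "of_nat (m b) * (?\<phi> b x - ?\<phi> b t) = of_int (u - v)"
        by (simp add: right_diff_distrib u v)
      also have "\<dots> = of_nat (m b) * (of_nat (k b * N) * of_int j)"
        unfolding j d_def by simp
      finally show ?thesis using m(1)[of b] by auto
    qed
    then obtain j where j: "\<And>b. b \<in> B \<Longrightarrow> ?\<phi> b x - ?\<phi> b t = of_nat (k b * N) * of_int (j b)" by metis
    have "x - t = (\<Sum>b\<in>B. of_rat (?\<phi> b x) * b) - (\<Sum>b\<in>B. of_rat (?\<phi> b t) * b)"
      by (simp add: sum_representation[OF B(2,3,1)])
    also have "\<dots> = (\<Sum>b\<in>B. of_rat (?\<phi> b x - ?\<phi> b t) * b)"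
      by (simp add: sum_subtractf of_rat_diff left_diff_distrib)
    also have "\<dots> = (\<Sum>b\<in>B. of_nat N * (of_int (j b) * (of_nat (k b) * b)))"
      by (rule sum.cong) (auto simp: j of_rat_mult)
    also have "\<dots> = of_nat N * (\<Sum>b\<in>B. of_int (j b) * (of_nat (k b) * b))"
      by (simp add: sum_distrib_left)
    finally have "(x - t) / of_nat N = (\<Sum>b\<in>B. of_int (j b) * (of_nat (k b) * b))"
      using N by simp
    also have "algebraic_int \<dots>"
      by (intro algebraic_int_sum algebraic_int_mult[OF algebraic_int_of_int] k(2))
    finally show ?thesis using t(1) by blast
  qed
  with T show ?thesis by (intro that[of T]) auto
qed

section \<open>Primes over a prime number\<close>

locale number_field_prime =
  fixes K :: "'a::field_char_0 itself" and p :: int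
  assumes number_field: "number_field TYPE('a)" and prime: "Factorial_Ring.prime p"
begin

lemma p_nonzero [simp]: "p \<noteq> 0"
  using prime by auto

lemma residues:
  obtains T :: "'a set" where "finite T" "\<And>t. t \<in> T \<Longrightarrow> algebraic_int t"
    "\<And>x. algebraic_int x \<Longrightarrow> \<exists>t\<in>T. algebraic_int ((x - t) / of_int p)"
proof -
  have p: "p > 0" using prime by (simp add: prime_gt_0_int)
  then have np: "nat p > 0" and eq: "of_nat (nat p) = (of_int p :: 'a)" by simp_all
  show ?thesis
  proof (rule finite_residues[OF number_field np], unfold eq)
    fix T :: "'a set"
    assume "finite T" "\<And>t. t \<in> T \<Longrightarrow> algebraic_int t"
      "\<And>x. algebraic_int x \<Longrightarrow> \<exists>t\<in>T. algebraic_int ((x - t) / of_int p)"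
    then show thesis by (rule that)
  qed
qed

lemma sequence_repeats_mod_p:
  fixes f :: "nat \<Rightarrow> 'a"
  assumes "\<And>i. algebraic_int (f i)"
  obtains i j where "i < j" "algebraic_int ((f j - f i) / of_int p)"
proof -
  obtain T :: "'a set" where T: "finite T" "\<And>t. t \<in> T \<Longrightarrow> algebraic_int t"
    "\<And>x. algebraic_int x \<Longrightarrow> \<exists>t\<in>T. algebraic_int ((x - t) / of_int p)"
    by (rule residues) blast
  have "\<forall>i. \<exists>t. t \<in> T \<and> algebraic_int ((f i - t) / of_int p)" using T(3) assms by blast
  then obtain t where t: "\<And>i. t i \<in> T" "\<And>i. algebraic_int ((f i - t i) / of_int p)" by metis
  have "\<not> inj_on t UNIV"
  proof
    assume "inj t"
    moreover have "finite (range t)" using t(1) by (intro finite_subset[OF _ T(1)]) auto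
    ultimately show False using finite_imageD infinite_UNIV_nat by blast
  qed
  then obtain i j where ij: "i < j" "t i = t j"
    by (metis inj_on_def linorder_neqE_nat)
  have "algebraic_int ((f j - t j) / of_int p - (f i - t i) / of_int p)"
    by (intro algebraic_int_diff t)
  then have "algebraic_int ((f j - f i) / of_int p)"
    using ij(2) by (simp flip: diff_divide_distrib)
  with ij(1) show ?thesis by (rule that)
qed

text \<open>
  An ideal containing \<open>p\<close> is a union of residue classes modulo \<open>p\<close>.
\<close>

lemma finite_ideals: "finite {I :: 'a set. ideal I ring_of_integers \<and> of_int p \<in> I}"
proof -
  obtain T :: "'a set" where T: "finite T" "\<And>t. t \<in> T \<Longrightarrow> algebraic_int t"
    "\<And>x. algebraic_int x \<Longrightarrow> \<exists>t\<in>T. algebraic_int ((x - t) / of_int p)"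
    by (rule residues) blast
  have sub: "I \<subseteq> J" if I: "ideal I ring_of_integers" and J: "ideal J ring_of_integers"
    and p: "of_int p \<in> I" "of_int p \<in> J" and eq: "I \<inter> T = J \<inter> T" for I J :: "'a set"
  proof
    fix x assume x: "x \<in> I"
    obtain t where t: "t \<in> T" "algebraic_int ((x - t) / of_int p)"
      using T(3) ideal_algebraic_int[OF I x] by blast
    have "x - t = (x - t) / of_int p * of_int p" by simp
    then have d: "x - t \<in> I" "x - t \<in> J" using ideal_mult[OF I t(2) p(1)] ideal_mult[OF J t(2) p(2)] by auto
    have "t \<in> I" using ideal_diff[OF I x d(1)] by simp
    then have "t \<in> J" using eq t(1) by blast
    from ideal_add[OF J this d(2)] show "x \<in> J" by simp
  qed
  have "inj_on (\<lambda>I. I \<inter> T) {I :: 'a set. ideal I ring_of_integers \<and> of_int p \<in> I}"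
    by (rule inj_onI) (use sub in blast)
  moreover have "(\<lambda>I. I \<inter> T) ` {I :: 'a set. ideal I ring_of_integers \<and> of_int p \<in> I} \<subseteq> Pow T" by auto
  ultimately show ?thesis using T(1) by (meson finite_Pow_iff finite_imageD finite_subset)
qed

text \<open>
  Two of the elements \<open>p \<gamma> ^ k\<close> agree modulo \<open>p\<close>, so \<open>\<gamma> ^ j - \<gamma> ^ i\<close> is an algebraic integer for some
  \<open>i < j\<close>, and \<open>\<gamma>\<close> is a root of a monic polynomial.  This form of integral closedness is used twice: to
  invert a prime ideal and to bound its exponent in \<open>p\<close>.
\<close>

lemma integral_if_powers_bounded:
  fixes \<gamma> :: 'a
  assumes "\<And>k. algebraic_int (of_int p * \<gamma> ^ k)"
  shows "algebraic_int \<gamma>"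
proof -
  obtain i j where ij: "i < j" "algebraic_int ((of_int p * \<gamma> ^ j - of_int p * \<gamma> ^ i) / of_int p)"
    using sequence_repeats_mod_p[of "\<lambda>k. of_int p * \<gamma> ^ k"] assms by blast
  have "algebraic_int (\<gamma> ^ j - \<gamma> ^ i)"
    using ij(2) by (simp add: diff_divide_distrib)
  then show ?thesis
  proof (rule algebraic_int_root)
    let ?q = "monom 1 j - monom 1 i :: 'a poly"
    have "degree ?q \<le> j"
      using ij(1) by (intro degree_diff_le) (auto intro: order_trans[OF degree_monom_le])
    moreover have c: "coeff ?q j = 1" using ij(1) by simp
    ultimately have deg: "degree ?q = j" by (intro antisym le_degree) auto
    show "poly ?q \<gamma> = \<gamma> ^ j - \<gamma> ^ i" by (simp add: poly_monom)
    show "\<forall>i. coeff ?q i \<in> \<int>" by simp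
    show "lead_coeff ?q = 1" "degree ?q > 0" using deg c ij(1) by auto
  qed
qed

text \<open>
  For a prime ideal, containing \<open>p\<close> is the same as meeting the integers in the multiples of \<open>p\<close>; the
  lemma \<open>primes_over_eq\<close> below makes the connection to \<open>primes_over\<close>.
\<close>

definition prime_over :: "'a set \<Rightarrow> bool" where
  "prime_over P \<longleftrightarrow> primeideal P ring_of_integers \<and> of_int p \<in> P"

lemma prime_over_ideal: "prime_over P \<Longrightarrow> ideal P ring_of_integers"
  and prime_over_p: "prime_over P \<Longrightarrow> of_int p \<in> P"
  by (auto simp: prime_over_def primeideal_def)

lemma prime_over_one:
  assumes "prime_over P"
  shows "1 \<notin> P"
proof -
  have "primeideal P ring_of_integers" using assms by (simp add: prime_over_def)
  from primeideal.I_notcarr[OF this] show ?thesis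
    by (simp only: ideal_eq_integers_iff[OF prime_over_ideal[OF assms]] simp_thms)
qed

lemma prime_over_mult:
  "prime_over P \<Longrightarrow> algebraic_int x \<Longrightarrow> algebraic_int y \<Longrightarrow> x * y \<in> P \<Longrightarrow> x \<in> P \<or> y \<in> P"
  using primeideal.I_prime[of P ring_of_integers x y] by (auto simp: prime_over_def)

lemma prime_over_power:
  assumes P: "prime_over P" and x: "algebraic_int x" and "x ^ k \<in> P"
  shows "x \<in> P"
  using assms(3)
proof (induction k)
  case 0
  then show ?case using prime_over_one[OF P] by simp
next
  case (Suc k)
  then show ?case using prime_over_mult[OF P x algebraic_int_power[OF x], of k] by auto
qed

text \<open>
  The residue ring is a finite domain, so some power of a nonzero residue class is \<open>1\<close>.
\<close>

lemma prime_over_unit: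
  assumes P: "prime_over P" and y: "algebraic_int y" "y \<notin> P"
  obtains d where "1 - y ^ Suc d \<in> P"
proof -
  obtain i j where ij: "i < j" "algebraic_int ((y ^ j - y ^ i) / of_int p)"
    using sequence_repeats_mod_p[of "\<lambda>k. y ^ k"] algebraic_int_power[OF y(1)] by blast
  define d where "d = j - i - 1"
  have j: "j = i + Suc d" using ij(1) by (simp add: d_def)
  have "y ^ j - y ^ i \<in> P"
    using ideal_mult[OF prime_over_ideal[OF P] ij(2) prime_over_p[OF P]] by simp
  then have "- 1 * (y ^ j - y ^ i) \<in> P"
    by (intro ideal_mult[OF prime_over_ideal[OF P]]) auto
  then have "y ^ i * (1 - y ^ Suc d) \<in> P"
    by (simp add: j power_add algebra_simps)
  then have "1 - y ^ Suc d \<in> P"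
    using prime_over_mult[OF P, of "y ^ i" "1 - y ^ Suc d"] prime_over_power[OF P y(1), of i] y
      algebraic_int_power[OF y(1), of i] algebraic_int_diff[OF algebraic_int_1 algebraic_int_power[OF y(1), of "Suc d"]]
    by blast
  then show ?thesis by (rule that)
qed

lemma primes_over_eq: "primes_over p = Finite_Place ` {P :: 'a set. prime_over P}"
proof -
  have "{k :: int. of_int k \<in> P} = {k. p dvd k} \<longleftrightarrow> of_int p \<in> P" if "primeideal P ring_of_integers" for P :: "'a set"
  proof
    assume "of_int p \<in> P"
    with that have P: "prime_over P" by (simp add: prime_over_def)
    have "of_int k \<in> P \<longleftrightarrow> p dvd k" for k
    proof
      assume "p dvd k"
      then obtain l where "k = l * p" by (metis dvdE mult.commute)
      then show "of_int k \<in> P"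
        using ideal_mult[OF prime_over_ideal[OF P], of "of_int l", OF _ prime_over_p[OF P]] by simp
    next
      assume k: "of_int k \<in> P"
      show "p dvd k"
      proof (rule ccontr)
        assume "\<not> p dvd k"
        then have "Rings.coprime p k" using prime by (simp add: prime_imp_coprime)
        then obtain u v where "u * p + v * k = 1"
          by (metis bezout_int coprime_imp_gcd_eq_1)
        then have "of_int u * of_int p + of_int v * of_int k = (1 :: 'a)"
          by (metis of_int_1 of_int_add of_int_mult)
        moreover have "of_int u * of_int p + of_int v * of_int k \<in> P"
          using k prime_over_p[OF P] by (intro ideal_add ideal_mult prime_over_ideal[OF P]) auto
        ultimately show False using prime_over_one[OF P] by simp
      qed
    qed
    then show "{k :: int. of_int k \<in> P} = {k. p dvd k}" by simp
  next
    assume eq: "{k :: int. of_int k \<in> P} = {k. p dvd k}"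
    have "p \<in> {k. p dvd k}" by simp
    then show "of_int p \<in> P" unfolding eq[symmetric] by simp
  qed
  then have eq: "primeideal P ring_of_integers \<and> {k :: int. of_int k \<in> P} = {k. p dvd k} \<longleftrightarrow> prime_over P"
    for P :: "'a set"
    unfolding prime_over_def by blast
  have "p \<noteq> -1" using prime_gt_0_int[OF prime] by simp
  then show ?thesis
    unfolding primes_over_def eq by (simp only: if_False image_Collect)
qed

lemma finite_prime_over: "finite {P. prime_over P}"
  by (rule finite_subset[OF _ finite_ideals]) (auto simp: prime_over_ideal prime_over_p)

lemma conductor_ideal:
  assumes "algebraic_int x"
  shows "ideal {y. algebraic_int y \<and> algebraic_int (x * y / of_int p)} (ring_of_integers :: 'a ring)"
  unfolding ideal_ring_of_integers_iff
proof (intro conjI ballI allI impI)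
  fix y z assume "y \<in> {y. algebraic_int y \<and> algebraic_int (x * y / of_int p)}"
    "z \<in> {y. algebraic_int y \<and> algebraic_int (x * y / of_int p)}"
  then show "y + z \<in> {y. algebraic_int y \<and> algebraic_int (x * y / of_int p)}"
    by (auto simp: distrib_left add_divide_distrib intro: algebraic_int_add)
next
  fix r y :: 'a assume r: "algebraic_int r" and y: "y \<in> {y. algebraic_int y \<and> algebraic_int (x * y / of_int p)}"
  have "algebraic_int (r * (x * y / of_int p))" using y by (intro algebraic_int_mult[OF r]) simp
  then show "r * y \<in> {y. algebraic_int y \<and> algebraic_int (x * y / of_int p)}"
    using r y by (auto intro: algebraic_int_mult simp: mult.left_commute)
qed auto

section \<open>Inverses of prime ideals and ramification degrees\<close>

text \<open>
  In the finite ring of residues modulo \<open>p\<close>, the prime \<open>P\<close> is the annihilator of some element.  Take \<open>x\<close>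
  such that its annihilator \<open>A x\<close> is maximal among those contained in \<open>P\<close>, and let \<open>q\<close> be in \<open>P\<close>.  If some
  \<open>s\<close> outside \<open>P\<close> kills \<open>q * x\<close>, then \<open>A (s * x) = A x\<close> contains \<open>q\<close>.  Otherwise \<open>A (q ^ k * x) = A x\<close>
  for all \<open>k\<close>, and a coincidence \<open>q ^ i = q ^ j\<close> modulo \<open>p\<close> puts \<open>1 - q ^ (j - i)\<close> into \<open>P\<close>, which is absurd.
  The required \<open>\<gamma>\<close> is \<open>x / p\<close>.
\<close>

lemma prime_over_annihilator:
  assumes P: "prime_over P"
  obtains \<gamma> :: 'a where "\<not> algebraic_int \<gamma>" "\<And>y. y \<in> P \<Longrightarrow> algebraic_int (\<gamma> * y)"
proof -
  define A where "A = (\<lambda>x. {y :: 'a. algebraic_int y \<and> algebraic_int (x * y / of_int p)})"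
  define S where "S = {A x | x. algebraic_int x \<and> A x \<subseteq> P}"
  have PO: "algebraic_int y" if "y \<in> P" for y using ideal_algebraic_int[OF prime_over_ideal[OF P] that] .
  have mono: "A x \<subseteq> A (r * x)" if "algebraic_int r" for x r
  proof
    fix y assume "y \<in> A x"
    then have "algebraic_int (r * (x * y / of_int p))" "algebraic_int y"
      using algebraic_int_mult[OF that, of "x * y / of_int p"] by (simp_all add: A_def)
    then show "y \<in> A (r * x)" by (simp add: A_def mult.assoc)
  qed
  have A1: "A 1 \<subseteq> P"
  proof
    fix y assume "y \<in> A 1"
    then have "algebraic_int (y / of_int p)" by (simp add: A_def)
    from ideal_mult[OF prime_over_ideal[OF P] this prime_over_p[OF P]] show "y \<in> P" by simp
  qed
  have "S \<subseteq> {I. ideal I ring_of_integers \<and> of_int p \<in> I}"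
    by (auto simp: S_def A_def conductor_ideal)
  then have "finite S" using finite_ideals by (rule finite_subset)
  moreover have "A 1 \<in> S" using A1 by (auto simp: S_def)
  ultimately obtain M where "M \<in> S" and M: "\<And>I. I \<in> S \<Longrightarrow> M \<subseteq> I \<Longrightarrow> M = I"
    using finite_has_maximal[of S] by blast
  then obtain x where x: "algebraic_int x" "A x \<subseteq> P" "M = A x" by (auto simp: S_def)
  have max: "A (r * x) = A x" if "algebraic_int r" "A (r * x) \<subseteq> P" for r
  proof -
    have "A (r * x) \<in> S" using that algebraic_int_mult[OF that(1) x(1)] by (auto simp: S_def)
    from M[OF this] show ?thesis using mono[OF that(1), of x] x(3) by simp
  qed
  have "q \<in> A x" if q: "q \<in> P" for q
  proof (cases "A (q * x) \<subseteq> P")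
    case False
    then obtain s where s: "s \<in> A (q * x)" "s \<notin> P" by blast
    have si: "algebraic_int s" using s by (simp add: A_def)
    have "A (s * x) \<subseteq> P"
    proof
      fix y assume y: "y \<in> A (s * x)"
      then have "s * y \<in> A x" using si by (simp add: A_def mult_ac algebraic_int_mult)
      then have "s * y \<in> P" using x(2) by blast
      then show "y \<in> P" using prime_over_mult[OF P si, of y] y s(2) by (auto simp: A_def)
    qed
    from max[OF si this] have "A (s * x) = A x" .
    moreover have "q \<in> A (s * x)" using s(1) PO[OF q] by (simp add: A_def mult_ac)
    ultimately show ?thesis by simp
  next
    case True
    have "A (q ^ k * x) = A x" for k
    proof (induction k)
      case (Suc k)
      have "y \<in> A (q ^ Suc k * x) \<longleftrightarrow> y \<in> A x" for y
      proof (cases "algebraic_int y")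
        case y: True
        have "y \<in> A (q ^ Suc k * x) \<longleftrightarrow> q * y \<in> A (q ^ k * x)"
          using y PO[OF q] by (simp add: A_def algebraic_int_mult mult_ac)
        also have "\<dots> \<longleftrightarrow> y \<in> A (q * x)"
          unfolding Suc using y PO[OF q] by (simp add: A_def algebraic_int_mult mult_ac)
        also have "\<dots> \<longleftrightarrow> y \<in> A x" using max[OF PO[OF q] True] by simp
        finally show ?thesis .
      qed (simp add: A_def)
      then show ?case by blast
    qed simp
    moreover obtain i j where ij: "i < j" "algebraic_int ((q ^ j - q ^ i) / of_int p)"
      using sequence_repeats_mod_p[of "\<lambda>k. q ^ k"] algebraic_int_power[OF PO[OF q]] by blast
    define d where "d = j - i - 1"
    have j: "j = i + Suc d" using ij(1) by (simp add: d_def)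
    have "algebraic_int (- (x * ((q ^ j - q ^ i) / of_int p)))"
      using algebraic_int_mult[OF x(1) ij(2)] by simp
    then have "1 - q ^ Suc d \<in> A (q ^ i * x)"
      using algebraic_int_diff[OF algebraic_int_1 algebraic_int_power[OF PO[OF q], of "Suc d"]]
      by (simp add: A_def j power_add algebra_simps minus_divide_left)
    ultimately have "1 - q ^ Suc d \<in> P" using x(2) by blast
    moreover have "q ^ Suc d \<in> P"
      using ideal_mult[OF prime_over_ideal[OF P] algebraic_int_power[OF PO[OF q], of d] q] by (simp add: mult.commute)
    ultimately have "1 \<in> P" using ideal_add[OF prime_over_ideal[OF P]] by fastforce
    then show ?thesis using prime_over_one[OF P] by simp
  qed
  then have *: "algebraic_int (x / of_int p * y)" if "y \<in> P" for y
    using that by (auto simp: A_def)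
  show ?thesis
  proof (rule that[of "x / of_int p"])
    show "\<not> algebraic_int (x / of_int p)"
    proof
      assume "algebraic_int (x / of_int p)"
      then have "1 \<in> A x" by (simp add: A_def)
      then show False using x(2) prime_over_one[OF P] by blast
    qed
  qed (rule *)
qed

text \<open>
  The fractional ideal generated by \<open>1\<close> and \<open>\<gamma>\<close> is inverse to \<open>P\<close>.  Multiplication by \<open>\<gamma>\<close> cannot map \<open>P\<close>
  into itself, since then all \<open>\<gamma> ^ k * p\<close> would be algebraic integers and \<open>\<gamma>\<close> would be integral.  So
  some \<open>\<gamma> * q\<close> is a unit modulo \<open>P\<close>.
\<close>

lemma prime_over_inverse:
  assumes P: "prime_over P"
  obtains \<gamma> a q where "\<not> algebraic_int \<gamma>" "\<And>y. y \<in> P \<Longrightarrow> algebraic_int (\<gamma> * y)"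
    "a \<in> P" "q \<in> P" "a + \<gamma> * q = 1"
proof -
  note idP = prime_over_ideal[OF P]
  obtain \<gamma> where \<gamma>: "\<not> algebraic_int \<gamma>" "\<And>y. y \<in> P \<Longrightarrow> algebraic_int (\<gamma> * y)"
    using prime_over_annihilator[OF P] by blast
  have "\<exists>q\<in>P. \<gamma> * q \<notin> P"
  proof (rule ccontr)
    assume "\<not> (\<exists>q\<in>P. \<gamma> * q \<notin> P)"
    then have step: "\<gamma> * q \<in> P" if "q \<in> P" for q using that by blast
    have "of_int p * \<gamma> ^ k \<in> P" for k
    proof (induction k)
      case (Suc k)
      from step[OF this] show ?case by (simp add: mult_ac)
    qed (simp add: prime_over_p[OF P])
    then have "algebraic_int (of_int p * \<gamma> ^ k)" for k using ideal_algebraic_int[OF idP] by blast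
    from integral_if_powers_bounded[OF this] \<gamma>(1) show False by simp
  qed
  then obtain q where q: "q \<in> P" "\<gamma> * q \<notin> P" by blast
  obtain d where d: "1 - (\<gamma> * q) ^ Suc d \<in> P"
    using prime_over_unit[OF P \<gamma>(2)[OF q(1)] q(2)] by blast
  have "(\<gamma> * q) ^ d * q \<in> P"
    by (intro ideal_mult[OF idP] algebraic_int_power \<gamma>(2) q)
  moreover have "(1 - (\<gamma> * q) ^ Suc d) + \<gamma> * ((\<gamma> * q) ^ d * q) = 1"
    by (simp add: mult_ac)
  ultimately show ?thesis using that[OF \<gamma> d] by blast
qed

abbreviation ideal_monoid :: "'a set ring" where
  "ideal_monoid \<equiv> ideals_set ring_of_integers"

lemma ideal_power_ideal:
  assumes "ideal P (ring_of_integers :: 'a ring)"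
  shows "ideal (P [^]\<^bsub>ideal_monoid\<^esub> (n::nat)) ring_of_integers"
proof -
  interpret M: comm_monoid ideal_monoid
    by (rule ring_of_integers.ideals_set_is_comm_monoid)
  show ?thesis using M.nat_pow_closed[of P n] assms by (simp add: ideals_set_def)
qed

lemma ideal_power_Suc: "P [^]\<^bsub>ideal_monoid\<^esub> Suc n = ideal_prod ring_of_integers (P [^]\<^bsub>ideal_monoid\<^esub> n) P"
  by (simp add: ideals_set_def)

lemma ideal_power_zero: "P [^]\<^bsub>ideal_monoid\<^esub> (0::nat) = {x. algebraic_int x}"
  by (simp add: ideals_set_def)

lemma ideal_prod_mult:
  fixes x y :: 'a
  shows "x \<in> I \<Longrightarrow> y \<in> J \<Longrightarrow> x * y \<in> ideal_prod ring_of_integers I J"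
  using ideal_prod.prod[of x I y J "ring_of_integers :: 'a ring"] by simp

text \<open>
  The inverse of \<open>P ^ n\<close> is generated by the powers of \<open>\<gamma>\<close> up to \<open>n\<close>, so the cofactor \<open>J\<close> of \<open>P ^ n\<close> in \<open>p\<close>
  must be \<open>p\<close> times that module, which is an ideal precisely when the right-hand side holds.
\<close>

lemma ideal_divides_p_iff:
  assumes P: "prime_over P" and \<gamma>: "\<And>y. y \<in> P \<Longrightarrow> algebraic_int (\<gamma> * y)"
    and one: "a \<in> P" "q \<in> P" "a + \<gamma> * q = 1"
  shows "(P [^]\<^bsub>ideal_monoid\<^esub> n) divides\<^bsub>ideal_monoid\<^esub> (PIdl\<^bsub>ring_of_integers\<^esub> (of_int p)) \<longleftrightarrow>
    (\<forall>i\<le>n. algebraic_int (of_int p * \<gamma> ^ i))"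
proof -
  note idP = prime_over_ideal[OF P]
  have PI: "PIdl\<^bsub>ring_of_integers\<^esub> (of_int p) = {r * of_int p | r :: 'a. algebraic_int r}"
    by (simp add: cgenideal_def)
  have pow: "algebraic_int (\<gamma> ^ i * x)" if "x \<in> P [^]\<^bsub>ideal_monoid\<^esub> n" "i \<le> n" for x i n
    using that
  proof (induction n arbitrary: x i)
    case 0
    then show ?case unfolding ideal_power_zero by simp
  next
    case (Suc n)
    show ?case
    proof (cases i)
      case 0
      then show ?thesis using ideal_algebraic_int[OF ideal_power_ideal[OF idP] Suc.prems(1)] by simp
    next
      case (Suc j)
      then have j: "j \<le> n" using Suc.prems by simp
      have "x \<in> ideal_prod ring_of_integers (P [^]\<^bsub>ideal_monoid\<^esub> n) P"
        using Suc.prems(1) unfolding ideal_power_Suc .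
      then have "algebraic_int (\<gamma> ^ Suc j * x)"
      proof induction
        case (prod y z)
        have "algebraic_int ((\<gamma> ^ j * y) * (\<gamma> * z))"
          by (intro algebraic_int_mult Suc.IH prod j \<gamma>)
        then show ?case by (simp add: mult_ac)
      next
        case (sum y z)
        then show ?case by (simp add: distrib_left algebraic_int_add)
      qed
      then show ?thesis using Suc by simp
    qed
  qed
  show ?thesis
  proof
    assume "(P [^]\<^bsub>ideal_monoid\<^esub> n) divides\<^bsub>ideal_monoid\<^esub> (PIdl\<^bsub>ring_of_integers\<^esub> (of_int p))"
    then obtain J where J: "ideal J ring_of_integers"
      "{r * of_int p | r. algebraic_int r} = ideal_prod ring_of_integers (P [^]\<^bsub>ideal_monoid\<^esub> n) J"
      unfolding factor_def PI by (auto simp: ideals_set_def)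
    have "of_int p \<in> {r * of_int p | r :: 'a. algebraic_int r}" by (auto intro: exI[of _ 1])
    then have "of_int p \<in> P [^]\<^bsub>ideal_monoid\<^esub> n"
      unfolding J(2) using ring_of_integers.ideal_prod_inter[OF ideal_power_ideal[OF idP] J(1)] by blast
    from pow[OF this] show "\<forall>i\<le>n. algebraic_int (of_int p * \<gamma> ^ i)" by (simp add: mult.commute)
  next
    assume int: "\<forall>i\<le>n. algebraic_int (of_int p * \<gamma> ^ i)"
    define J where "J = {of_int p * (\<Sum>i\<le>n. u i * \<gamma> ^ i) | u. \<forall>i. algebraic_int (u i)}"
    have Jalt: "J = {(\<Sum>i\<le>n. u i * (of_int p * \<gamma> ^ i)) | u. \<forall>i. algebraic_int (u i)}"
      by (simp add: J_def sum_distrib_left mult.left_commute)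
    have J: "ideal J ring_of_integers"
      unfolding ideal_ring_of_integers_iff
    proof (intro conjI ballI allI impI)
      fix x assume "x \<in> J"
      then obtain u where x: "x = (\<Sum>i\<le>n. u i * (of_int p * \<gamma> ^ i))" and u: "\<And>i. algebraic_int (u i)"
        unfolding Jalt by blast
      show "algebraic_int x"
        unfolding x by (intro algebraic_int_sum algebraic_int_mult[OF u]) (use int in auto)
    next
      show "0 \<in> J" unfolding J_def by (auto intro!: exI[of _ "\<lambda>_. 0"])
    next
      fix x y assume "x \<in> J" "y \<in> J"
      then obtain u v where "x = of_int p * (\<Sum>i\<le>n. u i * \<gamma> ^ i)" "y = of_int p * (\<Sum>i\<le>n. v i * \<gamma> ^ i)"
        "\<And>i. algebraic_int (u i)" "\<And>i. algebraic_int (v i)" unfolding J_def by blast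
      then show "x + y \<in> J" unfolding J_def
        by (auto simp: distrib_left distrib_right sum.distrib algebraic_int_add intro!: exI[of _ "\<lambda>i. u i + v i"])
    next
      fix r x :: 'a assume r: "algebraic_int r" and "x \<in> J"
      then obtain u where "x = of_int p * (\<Sum>i\<le>n. u i * \<gamma> ^ i)" "\<And>i. algebraic_int (u i)"
        unfolding J_def by blast
      then show "r * x \<in> J" unfolding J_def using r
        by (auto simp: sum_distrib_left algebraic_int_mult mult_ac intro!: exI[of _ "\<lambda>i. r * u i"])
    qed
    have sub: "z \<in> {r * of_int p | r. algebraic_int r}"
      if "z \<in> ideal_prod ring_of_integers (P [^]\<^bsub>ideal_monoid\<^esub> n) J" for z
      using that
    proof induction
      case (prod x y)
      then obtain u where u: "y = of_int p * (\<Sum>i\<le>n. u i * \<gamma> ^ i)" "\<And>i. algebraic_int (u i)"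
        unfolding J_def by blast
      have "algebraic_int (\<Sum>i\<le>n. u i * (\<gamma> ^ i * x))"
        using pow[OF prod(1)] u(2) by (auto intro!: algebraic_int_sum algebraic_int_mult[OF u(2)])
      moreover have "x * y = (\<Sum>i\<le>n. u i * (\<gamma> ^ i * x)) * of_int p"
        by (simp add: u(1) sum_distrib_left sum_distrib_right mult_ac)
      ultimately show ?case by auto
    next
      case (sum x y)
      then obtain r s where "x = r * of_int p" "y = s * of_int p" "algebraic_int r" "algebraic_int s" by blast
      then show ?case by (auto intro!: exI[of _ "r + s"] simp: algebraic_int_add distrib_right)
    qed
    have mono: "a ^ (m - i) * q ^ i \<in> P [^]\<^bsub>ideal_monoid\<^esub> m" if "i \<le> m" for i m
      using that
    proof (induction m arbitrary: i)
      case 0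
      then show ?case unfolding ideal_power_zero by simp
    next
      case (Suc m)
      show ?case
      proof (cases "i \<le> m")
        case True
        from ideal_prod_mult[OF Suc.IH[OF this] one(1)] True show ?thesis
          unfolding ideal_power_Suc by (simp add: Suc_diff_le mult_ac)
      next
        case False
        then have "i = Suc m" using Suc.prems by simp
        with ideal_prod_mult[OF Suc.IH[of m] one(2)] show ?thesis
          unfolding ideal_power_Suc by (simp add: mult_ac)
      qed
    qed
    let ?PJ = "ideal_prod ring_of_integers (P [^]\<^bsub>ideal_monoid\<^esub> n) J"
    have idPJ: "ideal ?PJ ring_of_integers"
      by (rule ring_of_integers.ideal_prod_is_ideal[OF ideal_power_ideal[OF idP] J])
    have gen: "of_int p * \<gamma> ^ i \<in> J" if "i \<le> n" for i
      unfolding J_def using that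
      by (auto intro!: exI[of _ "\<lambda>j. if j = i then 1 else 0"] simp: mult_delta_left)
    \<comment> \<open>The binomial expansion of the \<open>n\<close>-th power of \<open>a + \<gamma> * q = 1\<close> exhibits \<open>p\<close> in the product.\<close>
    have "of_int p = of_int p * (\<gamma> * q + a) ^ n" using one(3) by (simp add: add.commute)
    also have "\<dots> = (\<Sum>i\<le>n. of_nat (n choose i) * ((a ^ (n - i) * q ^ i) * (of_int p * \<gamma> ^ i)))"
      unfolding binomial_ring sum_distrib_left
      by (rule sum.cong) (auto simp: power_mult_distrib)
    also have "\<dots> \<in> ?PJ"
    proof -
      have "of_nat (n choose i) * ((a ^ (n - i) * q ^ i) * (of_int p * \<gamma> ^ i)) \<in> ?PJ" if "i \<le> n" for i
        by (intro ideal_mult[OF idPJ] ideal_prod_mult mono gen that) auto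
      then have "(\<Sum>i\<in>I. of_nat (n choose i) * ((a ^ (n - i) * q ^ i) * (of_int p * \<gamma> ^ i))) \<in> ?PJ"
        if "I \<subseteq> {..n}" for I
        using that by (induction I rule: infinite_finite_induct) (auto intro: ideal_zero[OF idPJ] ideal_add[OF idPJ])
      then show ?thesis by blast
    qed
    finally have "of_int p \<in> ?PJ" .
    then have "{r * of_int p | r. algebraic_int r} = ?PJ"
      using sub ideal_mult[OF idPJ] by blast
    then show "(P [^]\<^bsub>ideal_monoid\<^esub> n) divides\<^bsub>ideal_monoid\<^esub> (PIdl\<^bsub>ring_of_integers\<^esub> (of_int p))"
      unfolding factor_def PI using J by (auto simp: ideals_set_def)
  qed
qed

text \<open>
  For \<open>n = 1\<close> the divisibility criterion holds since \<open>p\<close> is in \<open>P\<close>, and for large \<open>n\<close> it fails since \<open>\<gamma>\<close> is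
  not integral.  If \<open>p * \<gamma>\<close> were in \<open>P\<close>, then \<open>p * \<gamma> ^ 2\<close> would be integral and the criterion would hold
  for \<open>n = 2\<close>.
\<close>

lemma ramification_degree_inverse:
  assumes P: "prime_over P"
  obtains \<gamma> where "\<And>y. y \<in> P \<Longrightarrow> algebraic_int (\<gamma> * y)"
    "ramification_degree p (Finite_Place P) \<ge> 1"
    "ramification_degree p (Finite_Place P) = 1 \<Longrightarrow> of_int p * \<gamma> \<notin> P"
proof -
  obtain \<gamma> a q where \<gamma>: "\<not> algebraic_int \<gamma>" "\<And>y. y \<in> P \<Longrightarrow> algebraic_int (\<gamma> * y)"
    "a \<in> P" "q \<in> P" "a + \<gamma> * q = 1"
    using prime_over_inverse[OF P] by blast
  define D where "D = (\<lambda>n::nat. \<forall>i\<le>n. algebraic_int (of_int p * \<gamma> ^ i))"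
  have e: "ramification_degree p (Finite_Place P) = Greatest D"
    by (simp add: ideal_divides_p_iff[OF P \<gamma>(2-5)] D_def)
  obtain k where k: "\<not> algebraic_int (of_int p * \<gamma> ^ k)"
    using integral_if_powers_bounded \<gamma>(1) by blast
  have bound: "n \<le> k" if "D n" for n
    using that k unfolding D_def by (metis nat_le_linear)
  have p\<gamma>: "algebraic_int (of_int p * \<gamma>)"
    using \<gamma>(2)[OF prime_over_p[OF P]] by (simp add: mult.commute)
  have D1: "D 1" unfolding D_def using p\<gamma> by (auto simp: le_Suc_eq)
  show ?thesis
  proof (rule that[OF \<gamma>(2)])
    show "ramification_degree p (Finite_Place P) \<ge> 1"
      unfolding e using D1 bound by (rule Greatest_le_nat)
  next
    assume e1: "ramification_degree p (Finite_Place P) = 1"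
    show "of_int p * \<gamma> \<notin> P"
    proof
      assume "of_int p * \<gamma> \<in> P"
      from \<gamma>(2)[OF this] have "algebraic_int (of_int p * \<gamma> ^ 2)"
        by (simp add: power2_eq_square mult_ac)
      then have "D 2" unfolding D_def using p\<gamma> by (auto simp: le_Suc_eq numeral_2_eq_2)
      then have "2 \<le> Greatest D" using bound by (rule Greatest_le_nat)
      then show False using e1 unfolding e by simp
    qed
  qed
qed

text \<open>
  Among the finitely many proper ideals containing \<open>p\<close>, one that is maximal above \<open>C\<close> is a maximal
  ideal, hence prime.
\<close>

lemma exists_prime_over_containing:
  assumes C: "ideal C ring_of_integers" "of_int p \<in> C" "1 \<notin> C"
  obtains P where "prime_over P" "C \<subseteq> P"
proof -
  define S where "S = {I :: 'a set. ideal I ring_of_integers \<and> of_int p \<in> I \<and> 1 \<notin> I}"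
  have "finite S" by (rule finite_subset[OF _ finite_ideals]) (auto simp: S_def)
  moreover have "C \<in> S" using C by (simp add: S_def)
  ultimately obtain M where M: "M \<in> S" "C \<subseteq> M" "\<And>I. I \<in> S \<Longrightarrow> M \<subseteq> I \<Longrightarrow> M = I"
    using finite_has_maximal2[of S C] by blast
  have idM: "ideal M ring_of_integers" "of_int p \<in> M" "1 \<notin> M" using M(1) by (auto simp: S_def)
  have "maximalideal M ring_of_integers"
  proof (rule maximalidealI[OF idM(1)])
    show "carrier ring_of_integers \<noteq> M" using ideal_eq_integers_iff[OF idM(1)] idM(3) by blast
    fix J :: "'a set" assume J: "ideal J ring_of_integers" "M \<subseteq> J"
    show "J = M \<or> J = carrier ring_of_integers"
    proof (cases "1 \<in> J")
      case True
      then show ?thesis using ideal_eq_integers_iff[OF J(1)] by blast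
    next
      case False
      then have "J \<in> S" using J idM by (auto simp: S_def)
      from M(3)[OF this J(2)] show ?thesis by simp
    qed
  qed
  then have "prime_over M"
    using ring_of_integers.maximalideal_prime idM(2) by (simp add: prime_over_def)
  then show ?thesis using M(2) by (rule that)
qed

text \<open>
  Suppose that \<open>x\<close> is in all primes over \<open>p\<close> but not divisible by \<open>p\<close>.  The elements that multiply \<open>x\<close>
  into the multiples of \<open>p\<close> form a proper ideal, contained in some prime \<open>P\<close>.  But \<open>p * \<gamma>\<close> is one of
  these elements, and it is outside \<open>P\<close> because \<open>P\<close> is unramified.
\<close>

lemma unramified_intersection:
  assumes unram: "\<And>P. prime_over P \<Longrightarrow> ramification_degree p (Finite_Place P) = 1"
    and x: "algebraic_int x" "\<And>P. prime_over P \<Longrightarrow> x \<in> P"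
  shows "algebraic_int (x / of_int p)"
proof (rule ccontr)
  assume neg: "\<not> algebraic_int (x / of_int p)"
  let ?C = "{y. algebraic_int y \<and> algebraic_int (x * y / of_int p)}"
  obtain P where P: "prime_over P" "?C \<subseteq> P"
    using exists_prime_over_containing[OF conductor_ideal[OF x(1)]] neg x(1) by auto
  obtain \<gamma> where \<gamma>: "\<And>y. y \<in> P \<Longrightarrow> algebraic_int (\<gamma> * y)"
    "ramification_degree p (Finite_Place P) = 1 \<Longrightarrow> of_int p * \<gamma> \<notin> P"
    using ramification_degree_inverse[OF P(1)] by blast
  have "of_int p * \<gamma> \<in> ?C"
    using \<gamma>(1)[OF prime_over_p[OF P(1)]] \<gamma>(1)[OF x(2)[OF P(1)]] by (simp add: mult_ac)
  then show False using P(2) \<gamma>(2) unram[OF P(1)] by blast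
qed

section \<open>Residue fields\<close>

lemma coset_eq_iff:
  assumes P: "ideal P (ring_of_integers :: 'a ring)"
  shows "P +>\<^bsub>ring_of_integers\<^esub> x = P +>\<^bsub>ring_of_integers\<^esub> y \<longleftrightarrow> x - y \<in> P"
proof -
  have coset: "P +>\<^bsub>ring_of_integers\<^esub> z = {a + z | a. a \<in> P}" for z
    by (auto simp: a_r_coset_def')
  have sub: "{a + x | a. a \<in> P} \<subseteq> {a + y | a. a \<in> P}" if "x - y \<in> P" for x y
  proof safe
    fix a assume "a \<in> P"
    then have "a + (x - y) \<in> P" by (rule ideal_add[OF P _ that])
    then show "\<exists>b. a + x = b + y \<and> b \<in> P" by (intro exI[of _ "a + (x - y)"]) simp
  qed
  show ?thesis
  proof
    assume eq: "P +>\<^bsub>ring_of_integers\<^esub> x = P +>\<^bsub>ring_of_integers\<^esub> y"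
    have "0 + x \<in> {a + x | a. a \<in> P}" using ideal_zero[OF P] by blast
    then have "x \<in> {a + y | a. a \<in> P}" using eq unfolding coset by simp
    then show "x - y \<in> P" by auto
  next
    assume d: "x - y \<in> P"
    then have d': "y - x \<in> P" using ideal_mult[OF P, of "- 1" "x - y"] by simp
    show "P +>\<^bsub>ring_of_integers\<^esub> x = P +>\<^bsub>ring_of_integers\<^esub> y"
      unfolding coset by (rule subset_antisym[OF sub[OF d] sub[OF d']])
  qed
qed

lemma residue_ring_carrier:
  "carrier (ring_of_integers Quot P) = (\<lambda>x :: 'a. P +>\<^bsub>ring_of_integers\<^esub> x) ` {x. algebraic_int x}"
  by (auto simp: FactRing_def A_RCOSETS_def')

text \<open>
  The image of the integers is a field with at most \<open>p\<close> elements, and the residue field consists of the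
  combinations of a basis over it.  The dimension exists because the residue field is finite.
\<close>

lemma residue_field_card:
  assumes P: "prime_over P"
  shows "finite (carrier (ring_of_integers Quot P))"
    "card (carrier (ring_of_integers Quot P)) \<le> nat p ^ residue_degree (Finite_Place P)"
    "residue_degree (Finite_Place P) \<ge> 1"
proof -
  note idP = prime_over_ideal[OF P]
  let ?h = "\<lambda>x :: 'a. P +>\<^bsub>ring_of_integers\<^esub> x"
  let ?Q = "ring_of_integers Quot P"
  let ?F = "range (\<lambda>k :: int. ?h (of_int k))"
  interpret Q: domain ?Q
    using P primeideal.quotient_is_domain by (auto simp: prime_over_def)
  have hom: "?h \<in> Ring.ring_hom ring_of_integers ?Q"
    by (rule ideal.rcos_ring_hom[OF idP])
  have h_mult: "?h x \<otimes>\<^bsub>?Q\<^esub> ?h y = ?h (x * y)" and h_add: "?h x \<oplus>\<^bsub>?Q\<^esub> ?h y = ?h (x + y)"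
    if "algebraic_int x" "algebraic_int y" for x y
    using ring_hom_mult[OF hom, of x y] ring_hom_add[OF hom, of x y] that by simp_all
  have h_one: "\<one>\<^bsub>?Q\<^esub> = ?h 1" using ring_hom_one[OF hom] by simp
  have h_zero: "\<zero>\<^bsub>?Q\<^esub> = ?h 0"
    using ring_hom_zero[OF hom ring_of_integers.ring_axioms Q.ring_axioms] by simp
  have h_carr: "?h x \<in> carrier ?Q" if "algebraic_int x" for x
    using that unfolding residue_ring_carrier by blast
  show fin: "finite (carrier ?Q)"
  proof -
    obtain T :: "'a set" where T: "finite T" "\<And>t. t \<in> T \<Longrightarrow> algebraic_int t"
      "\<And>x. algebraic_int x \<Longrightarrow> \<exists>t\<in>T. algebraic_int ((x - t) / of_int p)"
      by (rule residues) blast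
    have "carrier ?Q \<subseteq> ?h ` T"
    proof
      fix c assume "c \<in> carrier ?Q"
      then obtain x where x: "algebraic_int x" "c = ?h x" unfolding residue_ring_carrier by blast
      obtain t where t: "t \<in> T" "algebraic_int ((x - t) / of_int p)" using T(3)[OF x(1)] by blast
      have "x - t \<in> P" using ideal_mult[OF idP t(2) prime_over_p[OF P]] by simp
      then show "c \<in> ?h ` T" using t(1) x(2) by (simp add: coset_eq_iff[OF idP])
    qed
    then show ?thesis using T(1) by (meson finite_imageI finite_subset)
  qed
  have "?F \<subseteq> (\<lambda>k :: int. ?h (of_int k)) ` {0..<p}"
  proof safe
    fix k :: int
    have "(of_int k - of_int (k mod p) :: 'a) = of_int (k div p) * of_int p"
      by (metis minus_mod_eq_div_mult of_int_diff of_int_mult)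
    also have "\<dots> \<in> P" by (intro ideal_mult[OF idP] prime_over_p[OF P]) auto
    finally have "?h (of_int k) = ?h (of_int (k mod p))" by (simp add: coset_eq_iff[OF idP])
    then show "?h (of_int k) \<in> (\<lambda>k :: int. ?h (of_int k)) ` {0..<p}"
      using prime_gt_0_int[OF prime] by (intro image_eqI[of _ _ "k mod p"]) auto
  qed
  note F_sub = this
  have finF: "finite ?F" by (rule finite_subset[OF F_sub]) simp
  have "card ?F \<le> card ((\<lambda>k :: int. ?h (of_int k)) ` {0..<p})"
    by (rule card_mono[OF _ F_sub]) simp
  also have "\<dots> \<le> card {0..<p}" by (rule card_image_le) simp
  finally have cardF: "card ?F \<le> nat p" by simp
  have ring: "subring ?F ?Q"
  proof (rule Q.subringI)
    show "?F \<subseteq> carrier ?Q" using h_carr by auto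
    show "\<one>\<^bsub>?Q\<^esub> \<in> ?F" unfolding h_one by (rule range_eqI[of _ _ 1]) simp
    fix x assume "x \<in> ?F"
    then obtain k :: int where k: "x = ?h (of_int k)" by blast
    have "?h (of_int (- k)) \<oplus>\<^bsub>?Q\<^esub> x = \<zero>\<^bsub>?Q\<^esub>" unfolding k h_zero by (subst h_add) simp_all
    then have "\<ominus>\<^bsub>?Q\<^esub> x = ?h (of_int (- k))"
      using Q.minus_equality[of "?h (of_int (- k))" x] h_carr by (simp add: k)
    then show "\<ominus>\<^bsub>?Q\<^esub> x \<in> ?F" by blast
    fix y assume "y \<in> ?F"
    then obtain l :: int where l: "y = ?h (of_int l)" by blast
    have "x \<otimes>\<^bsub>?Q\<^esub> y = ?h (of_int (k * l))" "x \<oplus>\<^bsub>?Q\<^esub> y = ?h (of_int (k + l))"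
      unfolding k l by (simp_all add: h_mult h_add)
    then show "x \<otimes>\<^bsub>?Q\<^esub> y \<in> ?F" "x \<oplus>\<^bsub>?Q\<^esub> y \<in> ?F" by blast+
  qed
  have sub: "subfield ?F ?Q"
  proof (rule Q.subfieldI[OF Q.subcringI'[OF ring]], rule subset_antisym)
    show "Units (?Q\<lparr>carrier := ?F\<rparr>) \<subseteq> ?F - {\<zero>\<^bsub>?Q\<^esub>}"
    proof
      fix x assume "x \<in> Units (?Q\<lparr>carrier := ?F\<rparr>)"
      then obtain y where x: "x \<in> ?F" and y: "y \<in> ?F" "x \<otimes>\<^bsub>?Q\<^esub> y = \<one>\<^bsub>?Q\<^esub>"
        by (auto simp: Units_def)
      have "y \<in> carrier ?Q" using y(1) h_carr by auto
      then have "x \<noteq> \<zero>\<^bsub>?Q\<^esub>" using y(2) Q.l_null[of y] Q.one_not_zero by metis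
      with x show "x \<in> ?F - {\<zero>\<^bsub>?Q\<^esub>}" by blast
    qed
    show "?F - {\<zero>\<^bsub>?Q\<^esub>} \<subseteq> Units (?Q\<lparr>carrier := ?F\<rparr>)"
    proof
      fix x assume x: "x \<in> ?F - {\<zero>\<^bsub>?Q\<^esub>}"
      then obtain k :: int where k: "x = ?h (of_int k)" by blast
      have "\<not> p dvd k"
      proof
        assume "p dvd k"
        then obtain l where "k = l * p" by (metis dvdE mult.commute)
        then have "of_int k - 0 \<in> P"
          using ideal_mult[OF idP, of "of_int l", OF _ prime_over_p[OF P]] by simp
        then have "x = \<zero>\<^bsub>?Q\<^esub>" unfolding k h_zero coset_eq_iff[OF idP] .
        with x show False by simp
      qed
      then have "Rings.coprime p k" using prime by (simp add: prime_imp_coprime)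
      then obtain u v where uv: "u * p + v * k = 1" by (metis bezout_int coprime_imp_gcd_eq_1)
      have "of_int (v * k) - 1 = (of_int (- u) * of_int p :: 'a)"
      proof -
        have "v * k - 1 = - u * p" using uv by simp
        then show ?thesis by (metis of_int_1 of_int_diff of_int_mult)
      qed
      also have "\<dots> \<in> P" by (intro ideal_mult[OF idP] prime_over_p[OF P]) auto
      finally have "?h (of_int (v * k)) = \<one>\<^bsub>?Q\<^esub>" unfolding h_one coset_eq_iff[OF idP] .
      then have "?h (of_int v) \<otimes>\<^bsub>?Q\<^esub> x = \<one>\<^bsub>?Q\<^esub>" "x \<otimes>\<^bsub>?Q\<^esub> ?h (of_int v) = \<one>\<^bsub>?Q\<^esub>"
        unfolding k by (simp_all add: h_mult mult.commute)
      then show "x \<in> Units (?Q\<lparr>carrier := ?F\<rparr>)" using x unfolding Units_def by auto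
    qed
  qed
  obtain Us where Us: "set Us = carrier ?Q" using finite_list[OF fin] by blast
  have "Q.Span ?F Us = carrier ?Q"
    using Q.Span_base_incl[OF sub, of Us] Q.Span_in_carrier[OF Q.subring_props(1)[OF sub], of Us] Us by auto
  then have "Q.finite_dimension ?F (carrier ?Q)"
    using Q.Span_finite_dimension[OF sub, of Us] Us by simp
  from Q.finite_dimensionE[OF sub this]
  have dim: "Q.dimension (residue_degree (Finite_Place P)) ?F (carrier ?Q)" by (simp add: over_def)
  show "residue_degree (Finite_Place P) \<ge> 1"
  proof (rule ccontr)
    assume "\<not> residue_degree (Finite_Place P) \<ge> 1"
    then have "residue_degree (Finite_Place P) = 0" by linarith
    with dim have "Q.dimension 0 ?F (carrier ?Q)" by (simp only:)
    from Q.dimension_zero[OF sub this] show False using Q.one_not_zero Q.one_closed by auto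
  qed
  obtain Vs where Vs: "set Vs \<subseteq> carrier ?Q" "length Vs = residue_degree (Finite_Place P)"
    "Q.Span ?F Vs = carrier ?Q"
    using Q.exists_base[OF sub dim] by blast
  let ?L = "{Ks. set Ks \<subseteq> ?F \<and> length Ks = residue_degree (Finite_Place P)}"
  have L: "carrier ?Q = (\<lambda>Ks. Q.combine Ks Vs) ` ?L"
    unfolding Vs(3)[symmetric] Q.Span_eq_combine_set_length_version[OF sub Vs(1)] Vs(2) by blast
  have "card (carrier ?Q) \<le> card ?L"
    by (rule order_trans[OF eq_refl[OF arg_cong[OF L, of card]] card_image_le[OF finite_lists_length_eq[OF finF]]])
  also have "\<dots> = card ?F ^ residue_degree (Finite_Place P)"
    by (rule card_lists_length_eq[OF finF])
  also have "\<dots> \<le> nat p ^ residue_degree (Finite_Place P)"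
    by (rule power_mono[OF cardF]) simp
  finally show "card (carrier ?Q) \<le> nat p ^ residue_degree (Finite_Place P)" .
qed

section \<open>Residue degrees and the degree of the field\<close>

definition spans_mod_p :: "'a set \<Rightarrow> bool" where
  "spans_mod_p W \<longleftrightarrow> finite W \<and> (\<forall>w\<in>W. algebraic_int w) \<and>
     (\<forall>x. algebraic_int x \<longrightarrow> (\<exists>z :: 'a \<Rightarrow> int. algebraic_int ((x - (\<Sum>w\<in>W. of_int (z w) * w)) / of_int p)))"

lemma exists_spans_mod_p: "\<exists>W. spans_mod_p W"
proof -
  obtain T :: "'a set" where T: "finite T" "\<And>t. t \<in> T \<Longrightarrow> algebraic_int t"
    "\<And>x. algebraic_int x \<Longrightarrow> \<exists>t\<in>T. algebraic_int ((x - t) / of_int p)"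
    by (rule residues) blast
  have "\<exists>z :: 'a \<Rightarrow> int. algebraic_int ((x - (\<Sum>w\<in>T. of_int (z w) * w)) / of_int p)"
    if x: "algebraic_int x" for x
  proof -
    obtain t where t: "t \<in> T" "algebraic_int ((x - t) / of_int p)" using T(3)[OF x] by blast
    have "(\<Sum>w\<in>T. of_int (if w = t then 1 else 0) * w) = (\<Sum>w\<in>T. if w = t then w else 0)"
      by (rule sum.cong) auto
    also have "\<dots> = t" using T(1) t(1) by simp
    finally show ?thesis using t(2) by (intro exI[of _ "\<lambda>w. if w = t then 1 else 0"]) simp
  qed
  then show ?thesis using T by (auto simp: spans_mod_p_def)
qed

text \<open>
  Otherwise there is a nonzero rational functional \<open>\<phi>\<close> that vanishes on \<open>W\<close>.  Some multiple \<open>m \<phi>\<close> takes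
  integral values on the algebraic integers.  Every algebraic integer is congruent to a combination of
  \<open>W\<close> modulo \<open>p\<close>, so these values are divisible by \<open>p\<close>, then by induction by all powers of \<open>p\<close>, and
  hence they vanish.  But every element of the field has a multiple that is an algebraic integer.
\<close>

lemma spans_mod_p_imp_spans:
  assumes W: "spans_mod_p W"
  shows "rat_scale.span W = UNIV"
proof (rule ccontr)
  assume "rat_scale.span W \<noteq> UNIV"
  then obtain v where v: "v \<notin> rat_scale.span W" by blast
  obtain C where C: "C \<subseteq> W" "rat_scale.independent C" "W \<subseteq> rat_scale.span C"
    using rat_scale.maximal_independent_subset[of W] by blast
  have vC: "v \<notin> rat_scale.span C" using v C(1) rat_scale.span_mono by blast
  define D where "D = rat_scale.extend_basis (insert v C)"
  have ind: "rat_scale.independent (insert v C)"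
    by (rule rat_scale.independent_insertI[OF vC C(2)])
  have D: "rat_scale.independent D" "rat_scale.span D = UNIV" "insert v C \<subseteq> D"
    unfolding D_def
    using rat_scale.independent_extend_basis[OF ind] rat_scale.span_extend_basis[OF ind]
      rat_scale.extend_basis_superset[OF ind] by auto
  define \<phi> where "\<phi> = (\<lambda>x. rat_scale.representation D x v)"
  have lin: "rat_linear \<phi>" unfolding \<phi>_def by (rule rat_linear_representation[OF D(1,2)])
  have \<phi>v: "\<phi> v = 1" using D by (simp add: \<phi>_def rat_scale.representation_basis)
  have \<phi>W: "\<phi> w = 0" if "w \<in> W" for w
  proof -
    have "w \<in> rat_scale.span C" using that C(3) by blast
    then have "rat_scale.representation D w = rat_scale.representation C w"
      using D by (intro rat_scale.representation_extend) auto
    moreover have "v \<notin> C" using vC rat_scale.span_base by blast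
    ultimately show ?thesis
      unfolding \<phi>_def using rat_scale.representation_ne_zero[of C w v] by auto
  qed
  obtain m :: nat where m: "m > 0" "\<And>x. algebraic_int x \<Longrightarrow> of_nat m * \<phi> x \<in> \<int>"
    using rational_functional_denominator[OF number_field lin] by blast
  \<comment> \<open>The values are divisible by arbitrary powers of \<open>p\<close>.\<close>
  have div: "\<exists>j. of_nat m * \<phi> x = of_int (p ^ k * j)" if "algebraic_int x" for x k
    using that
  proof (induction k arbitrary: x)
    case 0
    then show ?case using m(2)[of x] by (auto elim: Ints_cases)
  next
    case (Suc k)
    obtain z :: "'a \<Rightarrow> int" where z: "algebraic_int ((x - (\<Sum>w\<in>W. of_int (z w) * w)) / of_int p)"
      using W Suc.prems unfolding spans_mod_p_def by blast
    define y where "y = (x - (\<Sum>w\<in>W. of_int (z w) * w)) / of_int p"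
    have "x = (\<Sum>w\<in>W. of_int (z w) * w) + of_int p * y" by (simp add: y_def)
    then have "\<phi> x = of_int p * \<phi> y"
      by (simp add: rat_linear_add[OF lin] rat_linear_sum[OF lin] rat_linear_of_int[OF lin] \<phi>W)
    then have "of_nat m * \<phi> x = of_int p * (of_nat m * \<phi> y)" by simp
    also obtain j where "of_nat m * \<phi> y = of_int (p ^ k * j)"
      using Suc.IH[OF z] unfolding y_def by (elim exE)
    also have "of_int p * of_int (p ^ k * j) = (of_int (p ^ Suc k * j) :: rat)"
      by (simp add: mult.assoc)
    finally show ?case by (rule exI)
  qed
  obtain f where f: "f \<noteq> 0" "poly (map_poly of_rat f) v = 0"
    by (rule number_field_algebraic[OF number_field])
  then have "algebraic v" by (intro algebraicI'[of "map_poly of_rat f"]) (auto simp: coeff_map_poly)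
  then obtain N where N: "N > 0" "algebraic_int (of_nat N * v)" by (rule algebraic_imp_multiple_int)
  have "\<phi> (of_nat N * v) = of_nat N" by (simp add: rat_linear_of_nat[OF lin] \<phi>v)
  \<comment> \<open>The value at \<open>N * v\<close> is the positive integer \<open>m * N\<close>, which is less than \<open>p ^ (m * N)\<close>.\<close>
  then obtain j where "of_nat m * of_nat N = (of_int (p ^ (m * N) * j) :: rat)"
    using div[OF N(2), of "m * N"] by auto
  then have "(of_int (int (m * N)) :: rat) = of_int (p ^ (m * N) * j)" by simp
  then have eq: "int (m * N) = p ^ (m * N) * j" by (simp only: of_int_eq_iff)
  then have "p ^ (m * N) \<le> int (m * N)"
  proof (intro zdvd_imp_le)
    show "p ^ (m * N) dvd int (m * N)" unfolding eq by simp
    show "0 < int (m * N)" using m(1) N(1) by simp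
  qed
  moreover have "int (m * N) < 2 ^ (m * N)" by (metis of_nat_less_two_power)
  moreover have "(2::int) ^ (m * N) \<le> p ^ (m * N)"
    using prime_ge_2_int[OF prime] by (intro power_mono) auto
  ultimately show False by linarith
qed

text \<open>
  If the coefficient of \<open>w0\<close> in the relation is invertible modulo \<open>p\<close>, the relation expresses \<open>w0\<close> by
  the other elements, so that \<open>w0\<close> can be left out.
\<close>

lemma minimal_spans_mod_p_independent:
  assumes W: "spans_mod_p W" and min: "\<And>W'. spans_mod_p W' \<Longrightarrow> card W \<le> card W'"
    and rel: "algebraic_int ((\<Sum>w\<in>W. of_int (z w) * w) / of_int p)" and w0: "w0 \<in> W"
  shows "p dvd z w0"
proof (rule ccontr)
  assume "\<not> p dvd z w0"
  then have "Rings.coprime p (z w0)" using prime by (simp add: prime_imp_coprime)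
  then obtain v u where uv: "v * p + u * z w0 = 1" by (metis bezout_int coprime_imp_gcd_eq_1)
  have fin: "finite W" and WO: "\<And>w. w \<in> W \<Longrightarrow> algebraic_int w" using W by (auto simp: spans_mod_p_def)
  let ?W = "W - {w0}"
  let ?S = "\<Sum>w\<in>W. of_int (z w) * w"
  have "\<exists>y :: 'a \<Rightarrow> int. algebraic_int ((x - (\<Sum>w\<in>?W. of_int (y w) * w)) / of_int p)"
    if x: "algebraic_int x" for x
  proof -
    obtain y :: "'a \<Rightarrow> int" where y: "algebraic_int ((x - (\<Sum>w\<in>W. of_int (y w) * w)) / of_int p)"
      using W x by (auto simp: spans_mod_p_def)
    \<comment> \<open>Subtracting a multiple of the relation makes the coefficient of \<open>w0\<close> divisible by \<open>p\<close>.\<close>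
    let ?y = "\<lambda>w. y w - y w0 * u * z w"
    have "(\<Sum>w\<in>?W. of_int (?y w) * w) = (\<Sum>w\<in>W. of_int (?y w) * w) - of_int (?y w0) * w0"
      using fin w0 by (simp add: sum_diff1)
    also have "(\<Sum>w\<in>W. of_int (?y w) * w) = (\<Sum>w\<in>W. of_int (y w) * w) - of_int (y w0 * u) * ?S"
    proof -
      have "of_int (?y w) * w = of_int (y w) * w - of_int (y w0 * u) * (of_int (z w) * w)" for w
        unfolding of_int_diff of_int_mult left_diff_distrib by (simp only: mult.assoc)
      then show ?thesis by (simp only: sum_subtractf sum_distrib_left)
    qed
    also have "?y w0 = y w0 * v * p"
    proof -
      have "y w0 * 1 = y w0 * (v * p + u * z w0)" by (simp add: uv)
      then show ?thesis by (simp add: algebra_simps)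
    qed
    finally have eq: "(\<Sum>w\<in>?W. of_int (?y w) * w) =
        (\<Sum>w\<in>W. of_int (y w) * w) - of_int (y w0 * u) * ?S - of_int (y w0 * v * p) * w0" .
    have "(x - (b - c * S - of_int (d * p) * w0)) / of_int p = (x - b) / of_int p + c * (S / of_int p) + of_int d * w0"
      for b c S and d :: int
    proof -
      have "x - (b - c * S - of_int (d * p) * w0) = (x - b) + c * S + of_int p * (of_int d * w0)"
        by (simp add: algebra_simps)
      then show ?thesis by (simp only:) (simp add: add_divide_distrib)
    qed
    from this[of "\<Sum>w\<in>W. of_int (y w) * w" "of_int (y w0 * u)" ?S "y w0 * v"]
    have "(x - (\<Sum>w\<in>?W. of_int (?y w) * w)) / of_int p =
        (x - (\<Sum>w\<in>W. of_int (y w) * w)) / of_int p + of_int (y w0 * u) * (?S / of_int p) + of_int (y w0 * v) * w0"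
      unfolding eq .
    also have "algebraic_int \<dots>"
      by (intro algebraic_int_add y algebraic_int_mult[OF algebraic_int_of_int] rel WO w0)
    finally show ?thesis by (rule exI[where x = ?y])
  qed
  then have "spans_mod_p ?W" using fin WO by (simp add: spans_mod_p_def)
  from min[OF this] have "card W \<le> card ?W" .
  moreover have "card ?W < card W" by (rule card_Diff1_less[OF fin w0])
  ultimately show False by simp
qed

text \<open>
  Let \<open>W\<close> be a minimal set that generates the ring of integers modulo \<open>p\<close>.  It has at least as many
  elements as the degree.  The \<open>p ^ card W\<close> combinations of \<open>W\<close> with coefficients below \<open>p\<close> are pairwise
  incongruent modulo \<open>p\<close>.  In the unramified case they remain distinct in the product of the residue
  fields, which has at most \<open>p\<close> to the sum of the residue degrees many elements.
\<close>

theorem unramified_degree_le: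
  assumes unram: "\<And>P. prime_over P \<Longrightarrow> ramification_degree p (Finite_Place P) = 1"
  shows "field_degree TYPE('a) \<le> (\<Sum>P | prime_over P. residue_degree (Finite_Place P))"
proof -
  obtain W where W: "spans_mod_p W" and min: "\<And>W'. spans_mod_p W' \<Longrightarrow> card W \<le> card W'"
    using exists_spans_mod_p ex_has_least_nat[of spans_mod_p _ card] by blast
  have fin: "finite W" and WO: "\<And>w. w \<in> W \<Longrightarrow> algebraic_int w" using W by (auto simp: spans_mod_p_def)
  have p2: "p \<ge> 2" by (rule prime_ge_2_int[OF prime])
  define s where "s = (\<lambda>c :: 'a \<Rightarrow> int. \<Sum>w\<in>W. of_int (c w) * w)"
  have sO: "algebraic_int (s c)" for c
    unfolding s_def by (intro algebraic_int_sum algebraic_int_mult[OF algebraic_int_of_int] WO)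
  let ?Q = "\<lambda>P. carrier (ring_of_integers Quot P)"
  define \<Phi> where "\<Phi> = (\<lambda>c. \<lambda>P\<in>{P. prime_over P}. P +>\<^bsub>ring_of_integers\<^esub> s c)"
  have "inj_on \<Phi> (PiE W (\<lambda>_. {0..<p}))"
  proof (rule inj_onI)
    fix c c' assume c: "c \<in> PiE W (\<lambda>_. {0..<p})" "c' \<in> PiE W (\<lambda>_. {0..<p})" and eq: "\<Phi> c = \<Phi> c'"
    have "s c - s c' \<in> P" if P: "prime_over P" for P
      using fun_cong[OF eq, of P] P by (simp add: \<Phi>_def coset_eq_iff[OF prime_over_ideal[OF P]])
    then have "algebraic_int ((s c - s c') / of_int p)"
      by (intro unramified_intersection unram algebraic_int_diff sO)
    also have "s c - s c' = (\<Sum>w\<in>W. of_int (c w - c' w) * w)"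
      by (simp add: s_def sum_subtractf left_diff_distrib)
    finally have rel: "algebraic_int ((\<Sum>w\<in>W. of_int (c w - c' w) * w) / of_int p)" .
    have "c w = c' w" if w: "w \<in> W" for w
    proof -
      have "p dvd c w - c' w"
        by (rule minimal_spans_mod_p_independent[where z = "\<lambda>w. c w - c' w", OF W min rel w])
      moreover have "c w \<in> {0..<p}" "c' w \<in> {0..<p}" using c w by auto
      ultimately show ?thesis by (metis atLeastLessThan_iff mod_eq_dvd_iff mod_pos_pos_trivial)
    qed
    then show "c = c'" by (rule PiE_ext[OF c])
  qed
  moreover have "\<Phi> ` PiE W (\<lambda>_. {0..<p}) \<subseteq> PiE {P. prime_over P} ?Q"
    using sO by (auto simp: \<Phi>_def residue_ring_carrier)
  moreover have "finite (PiE {P. prime_over P} ?Q)"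
    using finite_prime_over residue_field_card(1) by (intro finite_PiE) auto
  ultimately have "card (PiE W (\<lambda>_. {0..<p})) \<le> card (PiE {P. prime_over P} ?Q)"
    by (rule card_inj_on_le)
  then have "nat p ^ card W \<le> (\<Prod>P | prime_over P. card (?Q P))"
    using fin finite_prime_over by (simp add: card_PiE)
  also have "\<dots> \<le> (\<Prod>P | prime_over P. nat p ^ residue_degree (Finite_Place P))"
    using residue_field_card(2) by (intro prod_mono) auto
  also have "\<dots> = nat p ^ (\<Sum>P | prime_over P. residue_degree (Finite_Place P))"
    by (simp add: power_sum)
  finally have "card W \<le> (\<Sum>P | prime_over P. residue_degree (Finite_Place P))"
    using p2 by (subst (asm) power_increasing_iff) auto
  moreover have "rat_scale.dim (UNIV :: 'a set) \<le> card W"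
    using rat_scale.dim_le_card[of UNIV W] spans_mod_p_imp_spans[OF W] fin by simp
  ultimately show ?thesis by (simp add: field_degree_def)
qed

end

section \<open>The ramification invariants\<close>

text \<open>
  Squaring is not injective on the nonzero residues, since \<open>1\<close> and \<open>p - 1\<close> have the same square, so it
  is not surjective.
\<close>

lemma exists_nonresidue:
  assumes p: "Factorial_Ring.prime (p :: int)" "p \<noteq> 2"
  shows "\<exists>k :: nat. 0 < k \<and> int k < p \<and> Legendre (int k) p = -1"
proof -
  have p3: "p \<ge> 3" using prime_ge_2_int[OF p(1)] p(2) by simp
  define sq where "sq = (\<lambda>y :: int. y\<^sup>2 mod p)"
  have "sq (p - 1) = sq 1"
  proof -
    have "(p - 1)\<^sup>2 = 1 + p * (p - 2)" by (simp add: power2_eq_square algebra_simps)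
    then show ?thesis by (simp add: sq_def)
  qed
  then have "\<not> inj_on sq {1..<p}" using p3 inj_onD[of sq "{1..<p}" "p - 1" 1] by auto
  moreover have "sq ` {1..<p} \<subseteq> {1..<p}"
  proof safe
    fix y assume y: "y \<in> {1..<p}"
    have "\<not> p dvd y\<^sup>2"
      using y p(1) zdvd_not_zless[of y p] by (auto simp: prime_dvd_power_iff)
    then have "sq y \<noteq> 0" by (simp add: sq_def dvd_eq_mod_eq_0)
    moreover have "sq y \<ge> 0" "sq y < p" using p3 by (simp_all add: sq_def)
    ultimately show "sq y \<in> {1..<p}" by simp
  qed
  ultimately have "sq ` {1..<p} \<noteq> {1..<p}" using eq_card_imp_inj_on[of "{1..<p}" sq] by auto
  with \<open>sq ` {1..<p} \<subseteq> {1..<p}\<close> obtain a where a: "a \<in> {1..<p}" "a \<notin> sq ` {1..<p}" by blast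
  have "\<not> QuadRes p a"
  proof
    assume "QuadRes p a"
    then obtain y where "[y\<^sup>2 = a] (mod p)" by (auto simp: QuadRes_def)
    then have y: "y\<^sup>2 mod p = a" using a(1) by (simp add: unique_euclidean_semiring_class.cong_def)
    then have sq: "sq (y mod p) = a" by (simp add: sq_def power_mod)
    then have "y mod p \<noteq> 0" using a(1) by (auto simp: sq_def)
    then have "y mod p \<in> {1..<p}" using p3 pos_mod_bound[of p y] pos_mod_sign[of p y] by auto
    with sq a(2) show False by blast
  qed
  moreover have "\<not> [a = 0] (mod p)" using a(1) by (simp add: unique_euclidean_semiring_class.cong_def)
  ultimately have "Legendre a p = -1" by (simp add: Legendre_def)
  with a(1) show ?thesis by (intro exI[of _ "nat a"]) simp
qed

lemma u_inv_prime:
  assumes p: "Factorial_Ring.prime (p :: int)"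
  shows "\<not> p dvd u_inv p" "\<not> u_inv p dvd 1"
proof -
  have p1: "p \<noteq> -1" using prime_gt_0_int[OF p] by simp
  have "\<not> p dvd u_inv p \<and> \<not> u_inv p dvd 1"
  proof (cases "p = 2")
    case True
    then show ?thesis by (simp add: u_inv_def)
  next
    case False
    define k where "k = (LEAST k :: nat. 0 < k \<and> int k < p \<and> Legendre (int k) p = -1)"
    have u: "u_inv p = int k" using p1 False by (simp add: u_inv_def k_def)
    have k: "0 < k" "int k < p" "Legendre (int k) p = -1"
      using LeastI_ex[OF exists_nonresidue[OF p False]] by (simp_all add: k_def)
    have "[1\<^sup>2 = 1] (mod p)" by simp
    then have "QuadRes p 1" unfolding QuadRes_def by blast
    then have "Legendre 1 p \<noteq> -1" by (simp add: Legendre_def)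
    with k(3) have "k \<noteq> 1" by auto
    then show ?thesis using k(1,2) zdvd_not_zless[of "int k" p] by (auto simp: u)
  qed
  then show "\<not> p dvd u_inv p" "\<not> u_inv p dvd 1" by simp_all
qed

lemma ramification_dvd_prod:
  fixes e m :: "'v \<Rightarrow> nat"
  assumes "finite V" "v \<in> V" "m v > 0"
  shows "int (e v) dvd (\<Prod>v\<in>V. int (e v) ^ m v)"
proof -
  have "int (e v) dvd int (e v) ^ m v" using assms(3) by (simp add: dvd_power)
  also have "int (e v) ^ m v dvd (\<Prod>v\<in>V. int (e v) ^ m v)" using assms(1,2) by (rule dvd_prodI)
  finally show ?thesis .
qed

text \<open>
  Every ramification degree greater than \<open>1\<close> divides the second invariant.  If all of them are \<open>1\<close>,
  the exponent of \<open>u_inv p\<close> is the degree minus the sum of the residue degrees as natural numbers, and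
  the hypothesis \<open>deg\<close> makes it vanish.
\<close>

lemma not_ramified_iff_beta:
  fixes p :: int
  assumes fin: "finite (primes_over p :: 'a::field_char_0 place set)"
    and pos: "\<And>v :: 'a place. v \<in> primes_over p \<Longrightarrow> ramification_degree p v \<ge> 1 \<and> residue_degree v \<ge> 1"
    and deg: "not_ramified TYPE('a) p \<Longrightarrow> field_degree TYPE('a) \<le> f_total TYPE('a) p"
  shows "not_ramified TYPE('a) p \<longleftrightarrow> ram_beta TYPE('a) p = 1"
proof
  let ?V = "primes_over p :: 'a place set"
  assume unram: "not_ramified TYPE('a) p"
  then have e: "\<And>v :: 'a place. v \<in> ?V \<Longrightarrow> ramification_degree p v = 1" by (simp add: not_ramified_def)
  have "e_total TYPE('a) p = num_primes TYPE('a) p"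
    using e by (simp add: e_total_def num_primes_def)
  then have "field_degree TYPE('a) + num_primes TYPE('a) p - (f_total TYPE('a) p + e_total TYPE('a) p) = 0"
    using deg[OF unram] by simp
  then show "ram_beta TYPE('a) p = 1" using e by (simp add: ram_beta_def)
next
  let ?V = "primes_over p :: 'a place set"
  assume beta: "ram_beta TYPE('a) p = 1"
  show "not_ramified TYPE('a) p"
    unfolding not_ramified_def
  proof (rule ballI, rule ccontr)
    fix v assume v: "v \<in> ?V" and ne: "ramification_degree p v \<noteq> 1"
    have "residue_degree v * (ramification_degree p v - 1) > 0"
      using pos[OF v] ne by simp
    from ramification_dvd_prod[OF fin v, where m = "\<lambda>v. residue_degree v * (ramification_degree p v - 1)", OF this]
    have "int (ramification_degree p v) dvd ram_beta TYPE('a) p"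
      unfolding ram_beta_def by (intro dvd_mult dvd_mult2)
    with beta ne show False by simp
  qed
qed

text \<open>
  If the first invariant is \<open>1\<close>, so are its divisors, the ramification degrees, and then the exponent
  of \<open>u_inv p\<close> must vanish.  At infinity \<open>u_inv p\<close> is a unit, but there all residue degrees are \<open>1\<close>.
\<close>

lemma totally_split_iff_alpha:
  fixes p :: int
  assumes fin: "finite (primes_over p :: 'a::field_char_0 place set)"
    and pos: "\<And>v :: 'a place. v \<in> primes_over p \<Longrightarrow> residue_degree v \<ge> 1"
    and u: "\<not> u_inv p dvd 1 \<or> (\<forall>v \<in> (primes_over p :: 'a place set). residue_degree v = 1)"
  shows "totally_split TYPE('a) p \<longleftrightarrow> ram_alpha TYPE('a) p = 1"
proof
  let ?V = "primes_over p :: 'a place set"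
  assume "totally_split TYPE('a) p"
  then have ef: "\<And>v :: 'a place. v \<in> ?V \<Longrightarrow> ramification_degree p v = 1 \<and> residue_degree v = 1"
    by (simp add: totally_split_def)
  then have "f_total TYPE('a) p = num_primes TYPE('a) p" by (simp add: f_total_def num_primes_def)
  then show "ram_alpha TYPE('a) p = 1" using ef by (simp add: ram_alpha_def)
next
  let ?V = "primes_over p :: 'a place set"
  assume alpha: "ram_alpha TYPE('a) p = 1"
  have e: "ramification_degree p v = 1" if v: "v \<in> ?V" for v
  proof -
    have "residue_degree v > 0" using pos[OF v] by simp
    from ramification_dvd_prod[OF fin v, where m = residue_degree, OF this]
    have "int (ramification_degree p v) dvd ram_alpha TYPE('a) p"
      unfolding ram_alpha_def by (rule dvd_mult2)
    with alpha show ?thesis by simp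
  qed
  have "residue_degree v = 1" if v: "v \<in> ?V" for v
  proof (rule ccontr)
    assume ne: "residue_degree v \<noteq> 1"
    then have u1: "\<not> u_inv p dvd 1" using u v by blast
    have "(\<Sum>v\<in>?V. 1) < (\<Sum>v\<in>?V. residue_degree v)"
    proof (rule sum_strict_mono_ex1[OF fin])
      show "\<forall>v\<in>?V. 1 \<le> residue_degree v" using pos by blast
      have "1 < residue_degree v" using pos[OF v] ne by linarith
      then show "\<exists>v\<in>?V. 1 < residue_degree v" using v by blast
    qed
    then have "f_total TYPE('a) p - num_primes TYPE('a) p > 0"
      by (simp add: f_total_def num_primes_def)
    then have "u_inv p dvd u_inv p ^ (f_total TYPE('a) p - num_primes TYPE('a) p)"
      by (simp add: dvd_power)
    also have "\<dots> dvd ram_alpha TYPE('a) p" unfolding ram_alpha_def by simp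
    finally show False using alpha u1 by simp
  qed
  with e show "totally_split TYPE('a) p" by (simp add: totally_split_def)
qed

lemma wildly_ramified_iff_alpha:
  fixes p :: int
  assumes fin: "finite (primes_over p :: 'a::field_char_0 place set)"
    and pos: "\<And>v :: 'a place. v \<in> primes_over p \<Longrightarrow> residue_degree v \<ge> 1"
    and p: "Factorial_Ring.prime p"
  shows "wildly_ramified TYPE('a) p \<longleftrightarrow> p \<noteq> -1 \<and> [ram_alpha TYPE('a) p = 0] (mod p)"
proof -
  let ?V = "primes_over p :: 'a place set"
  have p1: "p \<noteq> -1" using prime_gt_0_int[OF p] by simp
  have "p dvd ram_alpha TYPE('a) p \<longleftrightarrow> p dvd (\<Prod>v\<in>?V. int (ramification_degree p v) ^ residue_degree v)"
    using u_inv_prime(1)[OF p] prime_dvd_power[OF p, of "u_inv p"]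
    unfolding ram_alpha_def by (auto simp: prime_dvd_mult_iff[OF p])
  also have "\<dots> \<longleftrightarrow> (\<exists>v\<in>?V. p dvd int (ramification_degree p v) ^ residue_degree v)"
    using fin by (rule prime_dvd_prod_iff[OF _ p])
  also have "\<dots> \<longleftrightarrow> (\<exists>v\<in>?V. p dvd int (ramification_degree p v))"
  proof (rule bex_cong[OF refl])
    fix v assume "v \<in> ?V"
    from pos[OF this] show "p dvd int (ramification_degree p v) ^ residue_degree v \<longleftrightarrow> p dvd int (ramification_degree p v)"
      by (intro prime_dvd_power_iff[OF p]) simp
  qed
  finally show ?thesis using p1 by (simp add: wildly_ramified_def cong_0_iff)
qed

text \<open>
  In the unramified case all embeddings are real, so each place consists of a single embedding.
\<close>

lemma archimedean_degree_le:
  assumes K: "number_field TYPE('a::field_char_0)" and unram: "not_ramified TYPE('a) (-1)"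
  shows "field_degree TYPE('a) \<le> f_total TYPE('a) (-1)"
proof -
  let ?I = "\<lambda>\<sigma> :: 'a \<Rightarrow> complex. Infinite_Place {\<sigma>, cnj \<circ> \<sigma>}"
  have V: "primes_over (-1) = ?I ` embeddings" by (auto simp: primes_over_def)
  have real: "cnj \<circ> \<sigma> = \<sigma>" if "\<sigma> \<in> embeddings" for \<sigma> :: "'a \<Rightarrow> complex"
  proof -
    have "ramification_degree (-1) (?I \<sigma>) = 1" using unram that by (auto simp: not_ramified_def V)
    then have "range \<sigma> \<subseteq> \<real>" by (auto split: if_splits)
    then show ?thesis by (intro ext) (auto simp: Reals_cnj_iff[symmetric])
  qed
  have "inj_on ?I embeddings"
    by (rule inj_onI) (simp add: real)
  then have "card (primes_over (-1) :: 'a place set) = card (embeddings :: ('a \<Rightarrow> complex) set)"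
    unfolding V by (rule card_image)
  moreover have "f_total TYPE('a) (-1) = card (primes_over (-1) :: 'a place set)"
  proof -
    have "f_total TYPE('a) (-1) = (\<Sum>v \<in> (primes_over (-1) :: 'a place set). 1)"
      unfolding f_total_def by (rule sum.cong) (auto simp: V)
    then show ?thesis by simp
  qed
  ultimately show ?thesis using field_degree_le_card_embeddings[OF K] by simp
qed

theorem proposition2p4:
  fixes p :: int
  assumes "number_field TYPE('a::field_char_0)"
    and "rational_prime p"
  shows "(not_ramified TYPE('a) p \<longleftrightarrow> ram_beta TYPE('a) p = 1) \<and>
         (totally_split TYPE('a) p \<longleftrightarrow> ram_alpha TYPE('a) p = 1) \<and>
         (wildly_ramified TYPE('a) p \<longleftrightarrow> p \<noteq> -1 \<and> [ram_alpha TYPE('a) p = 0] (mod p))"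
proof (cases "p = -1")
  case True
  let ?V = "primes_over (-1) :: 'a place set"
  have V: "?V = (\<lambda>\<sigma>. Infinite_Place {\<sigma>, cnj \<circ> \<sigma>}) ` embeddings" by (auto simp: primes_over_def)
  have fin: "finite ?V" unfolding V using finite_embeddings[OF assms(1)] by simp
  have f: "residue_degree v = 1" if "v \<in> ?V" for v using that unfolding V by auto
  have e: "ramification_degree (-1) v \<ge> 1" if "v \<in> ?V" for v using that unfolding V by auto
  have "not_ramified TYPE('a) (-1) \<longleftrightarrow> ram_beta TYPE('a) (-1) = 1"
    using fin e f archimedean_degree_le[OF assms(1)] by (intro not_ramified_iff_beta) auto
  moreover have "totally_split TYPE('a) (-1) \<longleftrightarrow> ram_alpha TYPE('a) (-1) = 1"
    using fin f by (intro totally_split_iff_alpha) auto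
  ultimately show ?thesis using True by (simp add: wildly_ramified_def)
next
  case False
  then have p: "Factorial_Ring.prime p" using assms(2) by (simp add: rational_prime_def)
  interpret number_field_prime "TYPE('a)" p using assms(1) p by unfold_locales
  have V: "primes_over p = Finite_Place ` {P :: 'a set. prime_over P}" by (rule primes_over_eq)
  have fin: "finite (primes_over p :: 'a place set)" unfolding V using finite_prime_over by simp
  have pos: "ramification_degree p v \<ge> 1 \<and> residue_degree v \<ge> 1" if "v \<in> primes_over p" for v :: "'a place"
  proof -
    from that obtain P :: "'a set" where P: "prime_over P" "v = Finite_Place P" unfolding V by blast
    have "ramification_degree p (Finite_Place P) \<ge> 1" by (rule ramification_degree_inverse[OF P(1)])
    with residue_field_card(3)[OF P(1)] show ?thesis unfolding P(2) by blast
  qed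
  have deg: "field_degree TYPE('a) \<le> f_total TYPE('a) p" if unram: "not_ramified TYPE('a) p"
  proof -
    have "ramification_degree p (Finite_Place P) = 1" if "prime_over P" for P :: "'a set"
      using unram that unfolding not_ramified_def V by blast
    from unramified_degree_le[OF this]
    have "field_degree TYPE('a) \<le> (\<Sum>P | prime_over P. residue_degree (Finite_Place P))" .
    also have "\<dots> = f_total TYPE('a) p"
      unfolding f_total_def V by (subst sum.reindex) (auto simp: inj_on_def)
    finally show ?thesis .
  qed
  show ?thesis
    using not_ramified_iff_beta[OF fin pos deg] totally_split_iff_alpha[OF fin] u_inv_prime(2)[OF p]
      wildly_ramified_iff_alpha[OF fin _ p] pos by blast
qed

end
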